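(* Let $V$ be a finite-dimensional real vector space, let $n>2$, and let $\Lambda$ be a linear $n$-vector field on the dual space $V^*$. Then $\Lambda$ is a Nambu-Poisson tensor on $V^*$ if and only if $\Lambda$ is a Filippov tensor and $\Lambda$ is decomposable.
   Context: An $n$-vector field $\Lambda$ on a smooth manifold $M$ defines an $n$-linear skew-symmetric bracket $\{f_1,\dots,f_n\}=\Lambda_{f_1,\dots,f_n}:=i_{df_n}\cdots i_{df_1}\Lambda$ on $C^\infty(M)$. The Filippov identity for an $n$-linear skew-symmetric bracket $[\cdot,\dots,\cdot]$ is $$[f_1,\dots,f_{n-1},[g_1,\dots,g_n]]=\sum_{i=1}^n[g_1,\dots,g_{i-1},[f_1,\dots,f_{n-1},g_i],g_{i+1},\dots,g_n].$$ $\Lambda$ is a Nambu-Poisson tensor of order $n$ if its bracket satisfies the Filippov identity for all functions in $C^\infty(M)$. An $n$-vector field $\Lambda$ on $V^*$ is linear if its coefficients in linear coordinates are linear functions; equivalently, the bracket of linear functions (elements of $V$) is again a linear function. A linear $n$-vector field $\Lambda$ on $V^*$ is a Filippov tensor if its bracket, restricted to linear functions on $V^*$ (i.e. to $V$), satisfies the Filippov identity. An $n$-vector field $\Lambda$ is decomposable if, at each point $p$, $\Lambda(p)$ is of the form $v_1\wedge\cdots\wedge v_n$ (possibly zero), i.e. it has rank $n$ at each point where it does not vanish. *)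

theory Defs
  imports "HOL-Analysis.Analysis"
begin

section \<open>Smooth functions and differentials\<close>

text \<open>
  The manifolds needed here are finite-dimensional real vector spaces, represented by types of
  class \<^class>\<open>real_normed_vector\<close>.  In finite dimension all norms are equivalent, so nothing below
  depends on the norm.  Likewise the directional formulation of \<open>C\<^sup>k\<close> is the usual one there.
\<close>

primrec C_k :: "nat \<Rightarrow> ('m::real_normed_vector \<Rightarrow> real) \<Rightarrow> bool" where
  "C_k 0 f \<longleftrightarrow> continuous_on UNIV f"
| "C_k (Suc k) f \<longleftrightarrow>
     (\<forall>x. f differentiable (at x)) \<and> (\<forall>v. C_k k (\<lambda>x. frechet_derivative f (at x) v))"

definition smooth :: "('m::real_normed_vector \<Rightarrow> real) \<Rightarrow> bool" where
  "smooth f \<longleftrightarrow> (\<forall>k. C_k k f)"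

definition differential :: "('m::real_normed_vector \<Rightarrow> real) \<Rightarrow> 'm \<Rightarrow> ('m \<Rightarrow>\<^sub>L real)" where
  "differential f p = Blinfun (frechet_derivative f (at p))"


section \<open>Multivectors and multivector fields\<close>

text \<open>
  An \<open>n\<close>-vector on a finite-dimensional space is identified with an alternating \<open>n\<close>-linear form on
  the dual space.  The arguments of the form are collected in a list; its values on lists of length
  other than \<open>n\<close> are irrelevant.
\<close>

type_synonym 'm multivector = "('m \<Rightarrow>\<^sub>L real) list \<Rightarrow> real"

definition is_multivector :: "nat \<Rightarrow> 'm::real_normed_vector multivector \<Rightarrow> bool" where
  "is_multivector n T \<longleftrightarrow>
     (\<forall>\<alpha>s i. length \<alpha>s = n \<longrightarrow> i < n \<longrightarrow> linear (\<lambda>\<alpha>. T (\<alpha>s[i := \<alpha>]))) \<and>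
     (\<forall>\<alpha>s i j. length \<alpha>s = n \<longrightarrow> i < n \<longrightarrow> j < n \<longrightarrow> i \<noteq> j \<longrightarrow> \<alpha>s ! i = \<alpha>s ! j \<longrightarrow> T \<alpha>s = 0)"

text \<open>
  \<open>v\<^sub>1 \<and> \<dots> \<and> v\<^sub>n\<close> as a form: its value at \<open>(\<alpha>\<^sub>1, \<dots>, \<alpha>\<^sub>n)\<close> is the determinant of the matrix
  \<open>\<alpha>\<^sub>i(v\<^sub>j)\<close>.
\<close>

definition wedge :: "'m::real_normed_vector list \<Rightarrow> 'm multivector" where
  "wedge vs \<alpha>s =
     (\<Sum>\<pi> | \<pi> permutes {..<length vs}.
        of_int (sign \<pi>) * (\<Prod>i<length vs. blinfun_apply (\<alpha>s ! i) (vs ! \<pi> i)))"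

type_synonym 'm multivector_field = "'m \<Rightarrow> 'm multivector"

definition is_multivector_field :: "nat \<Rightarrow> 'm::real_normed_vector multivector_field \<Rightarrow> bool" where
  "is_multivector_field n \<Lambda> \<longleftrightarrow>
     (\<forall>p. is_multivector n (\<Lambda> p)) \<and>
     (\<forall>\<alpha>s. length \<alpha>s = n \<longrightarrow> smooth (\<lambda>p. \<Lambda> p \<alpha>s))"

definition decomposable :: "nat \<Rightarrow> 'm::real_normed_vector multivector_field \<Rightarrow> bool" where
  "decomposable n \<Lambda> \<longleftrightarrow>
     (\<forall>p. \<exists>vs. length vs = n \<and> (\<forall>\<alpha>s. length \<alpha>s = n \<longrightarrow> \<Lambda> p \<alpha>s = wedge vs \<alpha>s))"

text \<open>
  The contraction \<open>i_{df\<^sub>n} \<dots> i_{df\<^sub>1} \<Lambda>\<close> inserts \<open>df\<^sub>1\<close> into the first slot, then \<open>df\<^sub>2\<close> into the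
  first remaining slot, and so on; the result is \<open>\<Lambda>(df\<^sub>1, \<dots>, df\<^sub>n)\<close>.
\<close>

definition bracket ::
    "'m::real_normed_vector multivector_field \<Rightarrow> ('m \<Rightarrow> real) list \<Rightarrow> 'm \<Rightarrow> real" where
  "bracket \<Lambda> fs = (\<lambda>p. \<Lambda> p (map (\<lambda>f. differential f p) fs))"

text \<open>The Filippov identity of an \<open>n\<close>-ary bracket of functions, for arguments taken from \<open>S\<close>.\<close>

definition filippov_identity_on ::
    "nat \<Rightarrow> ('m \<Rightarrow> real) set \<Rightarrow> (('m \<Rightarrow> real) list \<Rightarrow> 'm \<Rightarrow> real) \<Rightarrow> bool" where
  "filippov_identity_on n S br \<longleftrightarrow>
     (\<forall>fs gs. length fs + 1 = n \<longrightarrow> length gs = n \<longrightarrow> set fs \<subseteq> S \<longrightarrow> set gs \<subseteq> S \<longrightarrow>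
        (\<forall>p. br (fs @ [br gs]) p = (\<Sum>i<n. br (gs[i := br (fs @ [gs ! i])]) p)))"

definition nambu_poisson :: "nat \<Rightarrow> 'm::real_normed_vector multivector_field \<Rightarrow> bool" where
  "nambu_poisson n \<Lambda> \<longleftrightarrow>
     is_multivector_field n \<Lambda> \<and> filippov_identity_on n {f. smooth f} (bracket \<Lambda>)"


section \<open>Linear multivector fields on a dual space\<close>

type_synonym 'v dual = "'v \<Rightarrow>\<^sub>L real"

definition lin_fun :: "'v::real_normed_vector \<Rightarrow> 'v dual \<Rightarrow> real" where
  "lin_fun v = (\<lambda>\<phi>. blinfun_apply \<phi> v)"

text \<open>
  Linear functions on the dual of a finite-dimensional \<open>V\<close> are precisely the elements of
  \<open>range lin_fun\<close>.  Brackets of linear coordinate functions are the coefficients of \<open>\<Lambda>\<close>.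
\<close>

definition linear_multivector_field ::
    "nat \<Rightarrow> 'v::real_normed_vector dual multivector_field \<Rightarrow> bool" where
  "linear_multivector_field n \<Lambda> \<longleftrightarrow>
     is_multivector_field n \<Lambda> \<and>
     (\<forall>vs. length vs = n \<longrightarrow> linear (bracket \<Lambda> (map lin_fun vs)))"

definition filippov_tensor ::
    "nat \<Rightarrow> 'v::real_normed_vector dual multivector_field \<Rightarrow> bool" where
  "filippov_tensor n \<Lambda> \<longleftrightarrow>
     linear_multivector_field n \<Lambda> \<and> filippov_identity_on n (range lin_fun) (bracket \<Lambda>)"

end

theory Submission
  imports Defs "Jordan_Normal_Form.Determinant"
begin

text \<open>
  Write \<open>W\<close> for the dual space on which \<open>\<Lambda>\<close> lives.  Fix functions \<open>f\<^sub>1, \<dots>, f\<^sub>n\<^sub>-\<^sub>1\<close> and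
  \<open>g\<^sub>1, \<dots>, g\<^sub>n\<close>, and consider, at a point \<open>p\<close>, the difference of the two sides of the Filippov
  identity.  The product rule expresses it through the first and second derivatives of the functions
  at \<open>p\<close>.  Three kinds of terms arise.

  \<^item> Terms with the Hessian of some \<open>g\<^sub>i\<close>.  They occur once on each side, through the covector \<open>H(X, \<cdot>)\<close>
    on the left and \<open>H(\<cdot>, X)\<close> on the right, where \<open>X\<close> is the Hamiltonian vector of
    the \<open>f\<^sub>j\<close>.  They cancel because second derivatives are symmetric (\<open>second_derivative_symmetric\<close>).

  \<^item> Terms without second derivatives.  They depend only on the differentials at \<open>p\<close>, and every
    covector is the differential of a linear function, for which all Hessians vanish.  Hence they
    vanish for all functions exactly if the Filippov identity holds for linear functions.

  \<^item> Terms with the Hessian of some \<open>f\<^sub>j\<close>.  They do not involve the derivative of \<open>\<Lambda>\<close>, so that they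
    pose a condition on the single alternating form \<open>\<Lambda>(p)\<close>.  For the Hessian \<open>2 a \<otimes> a\<close> of a square
    this condition is the quadratic relation
    \<open>\<Sum>\<^sub>i T(a, \<dots>, \<beta>\<^sub>i) T(\<beta>\<^sub>1, \<dots>, a, \<dots>, \<beta>\<^sub>n) = 0\<close>, with \<open>a\<close> in place of \<open>\<beta>\<^sub>i\<close> in the second factor.

  This decomposition is \<open>filippov_defect\<close>.  It remains to see that the third condition amounts to
  decomposability.  If \<open>T\<close> is decomposable, Cramer's rule gives the Pluecker relation
  \<open>\<Sum>\<^sub>i T(\<gamma>, \<beta>\<^sub>i) T(\<beta>\<^sub>1, \<dots>, a, \<dots>, \<beta>\<^sub>n) = T(\<gamma>, a) T(\<beta>)\<close> (\<open>wedge_pluecker\<close>); inserting a Hessian then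
  pairs a symmetric with an antisymmetric array (\<open>second_order_defect_wedge\<close>).  Conversely, if \<open>T\<close>
  satisfies the quadratic relation and is nonzero, say \<open>T(e\<^sub>1, \<dots>, e\<^sub>n) = 1\<close>, the covectors split
  into the span of the \<open>e\<^sub>i\<close> and the space \<open>K\<close> of those \<open>k\<close> with \<open>T(e\<^sub>1, \<dots>, k, \<dots>, e\<^sub>n) = 0\<close> at every position of \<open>k\<close>.  The
  polarised relation shows that \<open>T\<close> vanishes as soon as one argument lies in \<open>K\<close>, and then \<open>T\<close> is the
  wedge of the vectors that represent the functionals \<open>T(e\<^sub>1, \<dots>, \<cdot>, \<dots>, e\<^sub>n)\<close>
  (\<open>decomposable_if_quadratic_relation\<close>).  Here \<open>n > 2\<close> enters: with one argument from \<open>K\<close> replacing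
  an \<open>e\<^sub>i\<close> and another one from \<open>K\<close> replacing an \<open>e\<^sub>j\<close>, some \<open>e\<^sub>l\<close> is still left.

  The space \<open>W\<close> consists of bounded functionals on a normed space without a given basis.  All that is
  used of its finite dimension is a finite frame, that is, covectors \<open>e\<^sub>k\<close> and vectors \<open>w\<^sub>k\<close> with
  \<open>x = \<Sum>\<^sub>k e\<^sub>k(x) w\<^sub>k\<close> for all \<open>x\<close>.  It makes linear functionals on \<open>W\<close> bounded and \<open>W\<close> reflexive.
\<close>

section \<open>Alternating forms on covectors\<close>

lemma multivector_linear:
  assumes "is_multivector n T" "length \<alpha>s = n" "i < n"
  shows "linear (\<lambda>\<alpha>. T (\<alpha>s[i := \<alpha>]))"
  using assms by (auto simp: is_multivector_def)

lemma multivector_repeated: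
  assumes "is_multivector n T" "length \<alpha>s = n" "i < n" "j < n" "i \<noteq> j" "\<alpha>s ! i = \<alpha>s ! j"
  shows "T \<alpha>s = 0"
  using assms unfolding is_multivector_def by blast

lemma multivector_append_linear:
  assumes T: "is_multivector n T" and n: "Suc (length \<gamma>) = n"
  shows "linear (\<lambda>\<delta>. T (\<gamma> @ [\<delta>]))"
  using multivector_linear[OF T, of "\<gamma> @ [0]" "length \<gamma>"] n by simp

lemma multivector_sum_update:
  assumes "is_multivector n T" "length \<alpha>s = n" "i < n"
  shows "T (\<alpha>s[i := (\<Sum>k\<in>A. c k *\<^sub>R x k)]) = (\<Sum>k\<in>A. c k * T (\<alpha>s[i := x k]))"
  using linear_sum[OF multivector_linear[OF assms], of "\<lambda>k. c k *\<^sub>R x k" A]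
    linear_scale[OF multivector_linear[OF assms]] by simp

lemma multivector_swap:
  assumes T: "is_multivector n T" and n: "length xs = n" and ij: "i < n" "j < n" "i \<noteq> j"
  shows "T (xs[i := xs ! j, j := xs ! i]) = - T xs"
proof -
  define F where "F a b = T (xs[i := a, j := b])" for a b
  have F1: "F (a + b) c = F a c + F b c" for a b c
    using linear_add[OF multivector_linear[OF T, of "xs[j := c]" i]] n ij
    by (simp add: F_def list_update_swap)
  have F2: "F c (a + b) = F c a + F c b" for a b c
    using linear_add[OF multivector_linear[OF T, of "xs[i := c]" j]] n ij
    by (simp add: F_def)
  have F0: "F a a = 0" for a
    unfolding F_def using n ij by (intro multivector_repeated[OF T, of _ i j]) auto
  have "0 = F (xs ! i + xs ! j) (xs ! i + xs ! j)"
    by (rule F0[symmetric])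
  also have "\<dots> = F (xs ! i) (xs ! j) + F (xs ! j) (xs ! i)"
    by (simp only: F1 F2) (simp add: F0)
  finally show ?thesis
    using n ij by (simp add: F_def)
qed

text \<open>
  Reordering the arguments changes \<open>T\<close> only by a sign.  Stated with multisets, this lets vanishing
  results be proved with the relevant arguments in convenient positions.
\<close>
lemma multivector_zero_mset:
  assumes T: "is_multivector n T" and n: "length ys = n" and m: "mset xs = mset ys"
  shows "T xs = 0 \<longleftrightarrow> T ys = 0"
proof -
  obtain p where p: "p permutes {..<length ys}" and xs: "permute_list p ys = xs"
    using m by (rule mset_eq_permutation)
  have "\<forall>ys. length ys = n \<longrightarrow> (T (permute_list p ys) = 0 \<longleftrightarrow> T ys = 0)"
    using p[unfolded n] finite_lessThan
  proof (induction rule: permutes_induct)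
    case (swap a b p)
    show ?case
    proof (intro allI impI)
      fix ys :: "('a \<Rightarrow>\<^sub>L real) list" assume l: "length ys = n"
      have tr: "permute_list (Transposition.transpose a b) ys = ys[a := ys ! b, b := ys ! a]"
        using swap(1-3) l
        by (intro nth_equalityI) (auto simp: permute_list_def Transposition.transpose_def nth_list_update)
      have "permute_list (Transposition.transpose a b \<circ> p) ys = permute_list p (permute_list (Transposition.transpose a b) ys)"
        using swap l by (intro permute_list_compose) auto
      then show "T (permute_list (Transposition.transpose a b \<circ> p) ys) = 0 \<longleftrightarrow> T ys = 0"
        using swap l multivector_swap[OF T l, of a b] unfolding tr by simp
    qed
  qed auto
  then show ?thesis using xs n by auto
qed

section \<open>Wedge products and the Pluecker relation\<close>

definition pairing_matrix :: "'m::real_normed_vector list \<Rightarrow> ('m \<Rightarrow>\<^sub>L real) list \<Rightarrow> real mat" where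
  "pairing_matrix vs \<alpha>s =
     mat (length vs) (length vs) (\<lambda>(i, j). blinfun_apply (\<alpha>s ! i) (vs ! j))"

lemma pairing_matrix_carrier: "pairing_matrix vs \<alpha>s \<in> carrier_mat (length vs) (length vs)"
  by (simp add: pairing_matrix_def)

lemma wedge_eq_det: "wedge vs \<alpha>s = Determinant.det (pairing_matrix vs \<alpha>s)"
  unfolding wedge_def det_def'[OF pairing_matrix_carrier] lessThan_atLeast0
  by (intro sum.cong refl arg_cong2[where f = "(*)"] prod.cong)
     (auto simp: pairing_matrix_def permutes_in_image)

text \<open>
  Laplace expansion along row \<open>i\<close>, whose cofactors do not see the covector placed in that row.
\<close>
lemma wedge_update:
  assumes "length vs = n" "length \<alpha>s = n" "i < n"
  shows "wedge vs (\<alpha>s[i := \<alpha>]) =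
    (\<Sum>j<n. blinfun_apply \<alpha> (vs ! j) * cofactor (pairing_matrix vs \<alpha>s) i j)"
proof -
  have *: "mat_delete (pairing_matrix vs (\<alpha>s[i := \<alpha>])) i j = mat_delete (pairing_matrix vs \<alpha>s) i j"
    for j using assms
    by (auto simp: mat_delete_def pairing_matrix_def nth_list_update intro!: eq_matI)
  show ?thesis
    unfolding wedge_eq_det
    using laplace_expansion_row[OF pairing_matrix_carrier, of i vs "\<alpha>s[i := \<alpha>]"] assms
    by (simp add: cofactor_def * ) (simp add: pairing_matrix_def)
qed

lemma is_multivector_wedge:
  assumes "length vs = n"
  shows "is_multivector n (wedge vs)"
  unfolding is_multivector_def
proof (intro conjI allI impI)
  fix \<alpha>s :: "('a \<Rightarrow>\<^sub>L real) list" and i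
  assume "length \<alpha>s = n" "i < n"
  then show "linear (\<lambda>\<alpha>. wedge vs (\<alpha>s[i := \<alpha>]))"
    unfolding wedge_update[OF assms \<open>length \<alpha>s = n\<close> \<open>i < n\<close>]
    by (intro linearI)
       (auto simp: blinfun.add_left blinfun.scaleR_left sum.distrib sum_distrib_left algebra_simps)
next
  fix \<alpha>s :: "('a \<Rightarrow>\<^sub>L real) list" and i j
  assume *: "length \<alpha>s = n" "i < n" "j < n" "i \<noteq> j" "\<alpha>s ! i = \<alpha>s ! j"
  show "wedge vs \<alpha>s = 0"
    unfolding wedge_eq_det using * assms
    by (intro det_identical_rows[OF pairing_matrix_carrier, of i j])
       (auto simp: pairing_matrix_def intro!: eq_vecI)
qed

text \<open>
  Cramer's rule, free of division: the covectors \<open>T(\<beta>) a\<close> and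
  \<open>\<Sum>\<^sub>i T(\<beta>\<^sub>1, \<dots>, a, \<dots>, \<beta>\<^sub>n) \<beta>\<^sub>i\<close> agree on each \<open>v\<^sub>k\<close>.  It follows from the product of the adjugate with the matrix itself.
\<close>
lemma wedge_cramer:
  assumes vs: "length vs = n" and \<beta>: "length \<beta> = n" and k: "k < n"
  shows "(\<Sum>i<n. blinfun_apply (\<beta> ! i) (vs ! k) * wedge vs (\<beta>[i := a])) =
    blinfun_apply a (vs ! k) * wedge vs \<beta>"
proof -
  let ?M = "pairing_matrix vs \<beta>"
  have M: "?M \<in> carrier_mat n n" using pairing_matrix_carrier vs by metis
  have adj: "(\<Sum>i<n. cofactor ?M i j * blinfun_apply (\<beta> ! i) (vs ! k)) =
      (if j = k then wedge vs \<beta> else 0)" if j: "j < n" for j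
  proof -
    have "(adj_mat ?M * ?M) $$ (j, k) = (\<Sum>i<n. adj_mat ?M $$ (j, i) * ?M $$ (i, k))"
      using M adj_mat(1)[OF M] j k by (auto simp: scalar_prod_def lessThan_atLeast0 intro!: sum.cong)
    also have "\<dots> = (\<Sum>i<n. cofactor ?M i j * blinfun_apply (\<beta> ! i) (vs ! k))"
      using M j k vs by (intro sum.cong) (auto simp: adj_mat_def pairing_matrix_def)
    finally show ?thesis
      using adj_mat(3)[OF M] j k by (auto simp: wedge_eq_det)
  qed
  have "(\<Sum>i<n. blinfun_apply (\<beta> ! i) (vs ! k) * wedge vs (\<beta>[i := a])) =
      (\<Sum>i<n. \<Sum>j<n. blinfun_apply a (vs ! j) * (cofactor ?M i j * blinfun_apply (\<beta> ! i) (vs ! k)))"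
    by (intro sum.cong) (auto simp: wedge_update[OF vs \<beta>] sum_distrib_left algebra_simps)
  also have "\<dots> = (\<Sum>j<n. blinfun_apply a (vs ! j) *
      (\<Sum>i<n. cofactor ?M i j * blinfun_apply (\<beta> ! i) (vs ! k)))"
    by (subst sum.swap) (simp add: sum_distrib_left)
  also have "\<dots> = (\<Sum>j<n. if j = k then blinfun_apply a (vs ! j) * wedge vs \<beta> else 0)"
    by (intro sum.cong) (auto simp: adj)
  also have "\<dots> = blinfun_apply a (vs ! k) * wedge vs \<beta>"
    using k by simp
  finally show ?thesis .
qed

text \<open>
  As a function of its last argument, the wedge is a linear combination of the evaluations at the
  \<open>v\<^sub>k\<close>, so Cramer's rule applies to each of these evaluations.
\<close>
lemma wedge_pluecker:
  assumes vs: "length vs = n" and \<gamma>: "Suc (length \<gamma>) = n" and \<beta>: "length \<beta> = n"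
  shows "(\<Sum>i<n. wedge vs (\<gamma> @ [\<beta> ! i]) * wedge vs (\<beta>[i := a])) =
    wedge vs (\<gamma> @ [a]) * wedge vs \<beta>"
proof -
  define c where "c k = cofactor (pairing_matrix vs (\<gamma> @ [0])) (length \<gamma>) k" for k
  have last: "wedge vs (\<gamma> @ [\<delta>]) = (\<Sum>k<n. c k * blinfun_apply \<delta> (vs ! k))" for \<delta>
    using wedge_update[OF vs, of "\<gamma> @ [0]" "length \<gamma>" \<delta>] \<gamma> by (simp add: c_def mult.commute)
  have "(\<Sum>i<n. wedge vs (\<gamma> @ [\<beta> ! i]) * wedge vs (\<beta>[i := a])) =
      (\<Sum>i<n. \<Sum>k<n. c k * (blinfun_apply (\<beta> ! i) (vs ! k) * wedge vs (\<beta>[i := a])))"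
    by (simp add: last sum_distrib_right mult.assoc)
  also have "\<dots> = (\<Sum>k<n. c k * (\<Sum>i<n. blinfun_apply (\<beta> ! i) (vs ! k) * wedge vs (\<beta>[i := a])))"
    by (subst sum.swap) (simp add: sum_distrib_left)
  also have "\<dots> = wedge vs (\<gamma> @ [a]) * wedge vs \<beta>"
    by (simp add: wedge_cramer[OF vs \<beta>] last sum_distrib_right mult.assoc)
  finally show ?thesis .
qed

text \<open>
  By multilinearity the arguments may be replaced one after the other by members of \<open>e\<close>: the index
  \<open>j\<close> of the induction counts the leading arguments that are still arbitrary.  A list of members of \<open>e\<close>
  either has a repetition or is a reordering of \<open>e\<close>.
\<close>
lemma multivector_eq_0_if_frame:
  assumes D: "is_multivector n D" and e: "length e = n" "distinct e" and De: "D e = 0"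
    and kill: "\<And>xs i. length xs = n \<Longrightarrow> i < n \<Longrightarrow> xs ! i \<in> K \<Longrightarrow> D xs = 0"
    and split: "\<And>x. \<exists>c. \<exists>k\<in>K. x = (\<Sum>l<n. c l *\<^sub>R e ! l) + k"
    and xs: "length xs = n"
  shows "D xs = 0"
proof -
  have "j \<le> n \<Longrightarrow> length xs = n \<Longrightarrow> \<forall>i. j \<le> i \<longrightarrow> i < n \<longrightarrow> xs ! i \<in> set e \<Longrightarrow> D xs = 0" for j xs
  proof (induction j arbitrary: xs)
    case 0
    show ?case
    proof (cases "distinct xs")
      case True
      have "set xs \<subseteq> set e" using 0 by (auto simp: in_set_conv_nth)
      then have "set xs = set e"
        using True e 0 by (intro card_subset_eq) (auto simp: distinct_card)
      then have "mset xs = mset e" using True e by (simp add: set_eq_iff_mset_eq_distinct)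
      then show ?thesis using multivector_zero_mset[OF D e(1)] De by auto
    next
      case False
      then show ?thesis using multivector_repeated[OF D] 0 by (auto simp: distinct_conv_nth)
    qed
  next
    case (Suc j)
    obtain c k where k: "k \<in> K" and x: "xs ! j = (\<Sum>l<n. c l *\<^sub>R e ! l) + k"
      using split by blast
    have j: "j < n" using Suc by simp
    have "D (xs[j := e ! l]) = 0" if "l < n" for l
      using Suc that e by (intro Suc.IH) (auto simp: nth_list_update)
    moreover have "D (xs[j := k]) = 0"
      using kill[of "xs[j := k]" j] Suc j k by simp
    moreover have "D xs = D (xs[j := (\<Sum>l<n. c l *\<^sub>R e ! l) + k])"
      using x by (metis list_update_id)
    moreover have "\<dots> = D (xs[j := (\<Sum>l<n. c l *\<^sub>R e ! l)]) + D (xs[j := k])"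
      by (rule linear_add[OF multivector_linear[OF D Suc.prems(2) j]])
    ultimately show ?case
      by (simp add: multivector_sum_update[OF D Suc.prems(2) j])
  qed
  from this[of n xs] xs show ?thesis by simp
qed


section \<open>The quadratic relation forces decomposability\<close>

text \<open>
  For \<open>T \<noteq> 0\<close>, the vectors of the decomposition are read off from a tuple \<open>e\<close> with \<open>T e = 1\<close>: \<open>v\<^sub>i\<close> represents the
  functional \<open>T(e\<^sub>1, \<dots>, \<cdot>, \<dots>, e\<^sub>n)\<close> with the free argument in position \<open>i\<close>.  Both \<open>T\<close> and the wedge of
  the \<open>v\<^sub>i\<close> have value 1 at \<open>e\<close>, and the wedge vanishes on the common kernel \<open>K\<close> of the \<open>v\<^sub>i\<close>.  The
  point is that the quadratic relation makes \<open>T\<close> vanish on \<open>K\<close> as well.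
\<close>
lemma decomposable_if_quadratic_relation:
  fixes T :: "'m::real_normed_vector multivector"
  assumes T: "is_multivector n T" and n: "n > 2"
    and reflexive: "\<And>L :: ('m \<Rightarrow>\<^sub>L real) \<Rightarrow> real. linear L \<Longrightarrow> \<exists>v. \<forall>\<alpha>. L \<alpha> = blinfun_apply \<alpha> v"
    and Q: "\<And>\<gamma> \<beta> a. Suc (length \<gamma>) = n \<Longrightarrow> length \<beta> = n \<Longrightarrow>
      (\<Sum>i<n. T (\<gamma>[0 := a] @ [\<beta> ! i]) * T (\<beta>[i := a])) = 0"
  shows "\<exists>vs. length vs = n \<and> (\<forall>\<alpha>s. length \<alpha>s = n \<longrightarrow> T \<alpha>s = wedge vs \<alpha>s)"
proof (cases "\<forall>\<alpha>s. length \<alpha>s = n \<longrightarrow> T \<alpha>s = 0")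
  case True
  have "wedge (replicate n 0) \<alpha>s = 0" if "length \<alpha>s = n" for \<alpha>s :: "('m \<Rightarrow>\<^sub>L real) list"
    using wedge_update[of "replicate n 0" n \<alpha>s 0 "\<alpha>s ! 0"] that n by (simp add: blinfun.zero_right)
  then show ?thesis using True by (intro exI[of _ "replicate n 0"]) auto
next
  case False
  then obtain e0 where e0: "length e0 = n" "T e0 \<noteq> 0" by blast
  define e where "e = e0[0 := (1 / T e0) *\<^sub>R e0 ! 0]"
  have le: "length e = n" using e0 by (simp add: e_def)
  have Te: "T e = 1"
    unfolding e_def using linear_scale[OF multivector_linear[OF T e0(1), of 0]] e0 n by simp
  have T_e_update: "T (e[i := e ! j]) = (if i = j then 1 else 0)" if "i < n" "j < n" for i j
    using multivector_repeated[OF T, of "e[i := e ! j]" i j] that le Te by auto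
  have de: "distinct e"
    using multivector_repeated[OF T le] Te le unfolding distinct_conv_nth by (metis zero_neq_one)
  have "\<exists>v. \<forall>\<alpha>. T (e[i := \<alpha>]) = blinfun_apply \<alpha> v" if "i < n" for i
    using reflexive[OF multivector_linear[OF T le that]] .
  then obtain v where v: "\<And>i \<alpha>. i < n \<Longrightarrow> T (e[i := \<alpha>]) = blinfun_apply \<alpha> (v i)"
    by metis
  define K where "K = {k. \<forall>i<n. T (e[i := k]) = 0}"
  have e_notin_K: "e ! j \<notin> K" if "j < n" for j
    using T_e_update[OF that that] that by (auto simp: K_def)
  have split: "\<exists>c. \<exists>k\<in>K. x = (\<Sum>l<n. c l *\<^sub>R e ! l) + k" for x
  proof -
    have "T (e[i := x - (\<Sum>l<n. T (e[l := x]) *\<^sub>R e ! l)]) = 0" if i: "i < n" for i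
    proof -
      have "T (e[i := (\<Sum>l<n. T (e[l := x]) *\<^sub>R e ! l)]) =
          (\<Sum>l<n. if i = l then T (e[l := x]) else 0)"
        unfolding multivector_sum_update[OF T le i] by (intro sum.cong) (auto simp: T_e_update i)
      then show ?thesis
        using linear_diff[OF multivector_linear[OF T le i]] i by simp
    qed
    then have "x - (\<Sum>l<n. T (e[l := x]) *\<^sub>R e ! l) \<in> K" by (simp add: K_def)
    moreover have "x = (\<Sum>l<n. T (e[l := x]) *\<^sub>R e ! l) + (x - (\<Sum>l<n. T (e[l := x]) *\<^sub>R e ! l))"
      by simp
    ultimately show ?thesis
      by (intro exI[of _ "\<lambda>l. T (e[l := x])"]) (rule bexI)
  qed
  \<comment> \<open>The relation is quadratic in \<open>a\<close>; its polarisation is bilinear in two independent covectors.\<close>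
  have polar: "(\<Sum>i<n. T (\<gamma>[0 := a] @ [\<beta> ! i]) * T (\<beta>[i := b])) +
      (\<Sum>i<n. T (\<gamma>[0 := b] @ [\<beta> ! i]) * T (\<beta>[i := a])) = 0"
    if l: "Suc (length \<gamma>) = n" "length \<beta> = n" for \<gamma> \<beta> a b
  proof -
    have 1: "T (\<gamma>[0 := a + b] @ [x]) = T (\<gamma>[0 := a] @ [x]) + T (\<gamma>[0 := b] @ [x])" for x
      using linear_add[OF multivector_linear[OF T, of "\<gamma> @ [x]" 0]] l n
      by (cases \<gamma>) auto
    have 2: "T (\<beta>[i := a + b]) = T (\<beta>[i := a]) + T (\<beta>[i := b])" if "i < n" for i
      using linear_add[OF multivector_linear[OF T l(2) that]] .
    have "0 = (\<Sum>i<n. T (\<gamma>[0 := a + b] @ [\<beta> ! i]) * T (\<beta>[i := a + b]))"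
      using Q[OF l, of "a + b"] by simp
    also have "\<dots> = (\<Sum>i<n. T (\<gamma>[0 := a] @ [\<beta> ! i]) * T (\<beta>[i := a])) +
        (\<Sum>i<n. T (\<gamma>[0 := b] @ [\<beta> ! i]) * T (\<beta>[i := b])) +
        (\<Sum>i<n. T (\<gamma>[0 := a] @ [\<beta> ! i]) * T (\<beta>[i := b])) +
        (\<Sum>i<n. T (\<gamma>[0 := b] @ [\<beta> ! i]) * T (\<beta>[i := a]))"
      unfolding sum.distrib[symmetric] by (intro sum.cong) (auto simp: 1 2 algebra_simps)
    finally show ?thesis using Q[OF l, of a] Q[OF l, of b] by simp
  qed
  \<comment> \<open>In the polarised relation at \<open>\<beta> = e\<close> with the pair \<open>(k, e\<^sub>j)\<close>, all but one term vanish.\<close>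
  have ends_Ke: "T (\<gamma>[0 := k] @ [e ! j]) = 0"
    if l: "Suc (length \<gamma>) = n" and k: "k \<in> K" and j: "j < n" for \<gamma> k j
  proof -
    have "(\<Sum>i<n. T (\<gamma>[0 := k] @ [e ! i]) * T (e[i := e ! j])) =
        (\<Sum>i<n. if i = j then T (\<gamma>[0 := k] @ [e ! j]) else 0)"
      by (intro sum.cong) (auto simp: T_e_update j)
    moreover have "(\<Sum>i<n. T (\<gamma>[0 := e ! j] @ [e ! i]) * T (e[i := k])) = 0"
      using k by (simp add: K_def)
    ultimately show ?thesis using polar[OF l le, of k "e ! j"] j by simp
  qed
  have mixed: "T xs = 0"
    if l: "length xs = n" and k: "k \<in> set xs" "k \<in> K" and x: "x \<in> set xs" "x \<in> set e" for xs k x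
  proof -
    obtain j where j: "j < n" "x = e ! j" using x le by (auto simp: in_set_conv_nth)
    obtain A where A: "mset xs = add_mset k A"
      using k multi_member_split[of k "mset xs"] by auto
    have "x \<in># mset xs" using x(1) by simp
    moreover have "x \<noteq> k" using k(2) e_notin_K[OF j(1)] j(2) by auto
    ultimately have "x \<in># A" unfolding A by simp
    then obtain B where B: "mset xs = add_mset k (add_mset x B)"
      using A multi_member_split[of x A] by auto
    obtain r where r: "mset r = B" using ex_mset by blast
    have m: "mset xs = mset ((k # r)[0 := k] @ [e ! j])" using B r j by simp
    have "Suc (length (k # r)) = n" using mset_eq_length[OF m] l by simp
    from ends_Ke[OF this k(2) j(1)] show ?thesis
      using multivector_zero_mset[OF T _ m] mset_eq_length[OF m] l by simp
  qed
  \<comment> \<open>Two arguments from \<open>K\<close>: take for \<open>\<beta>\<close> the tuple \<open>e\<close> with \<open>k\<close> as its last entry, and the pair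
    \<open>(e\<^sub>n, k')\<close>.  A term with \<open>i < n\<close> contains \<open>k\<close>, \<open>k'\<close> and, since \<open>n > 2\<close>, still some \<open>e\<^sub>q\<close>.\<close>
  have ends_KK: "T (\<gamma>[0 := k'] @ [k]) = 0"
    if l: "Suc (length \<gamma>) = n" and k: "k \<in> K" "k' \<in> K" for \<gamma> k k'
  proof -
    define \<beta> where "\<beta> = e[n - 1 := k]"
    have l\<beta>: "length \<beta> = n" using le by (simp add: \<beta>_def)
    define f where "f i = T (\<gamma>[0 := e ! (n - 1)] @ [\<beta> ! i]) * T (\<beta>[i := k']) +
        T (\<gamma>[0 := k'] @ [\<beta> ! i]) * T (\<beta>[i := e ! (n - 1)])" for i
    have "f i = 0" if i: "i < n" "i \<noteq> n - 1" for i
    proof -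
      have "\<exists>q<n. q \<noteq> i \<and> q \<noteq> n - 1"
        using n by (intro exI[of _ "if i = 0 then 1 else 0"]) auto
      then obtain q where q: "q < n" "q \<noteq> i" "q \<noteq> n - 1" by blast
      have "T (\<beta>[i := k']) = 0"
      proof (rule mixed[of _ k' "e ! q"])
        show "k' \<in> set (\<beta>[i := k'])" using i l\<beta> by (simp add: set_update_memI)
        have "\<beta>[i := k'] ! q = e ! q" using q le by (simp add: \<beta>_def)
        then show "e ! q \<in> set (\<beta>[i := k'])" using q l\<beta> by (metis length_list_update nth_mem)
      qed (use l\<beta> k q le in auto)
      moreover have "T (\<gamma>[0 := k'] @ [\<beta> ! i]) = 0"
        using ends_Ke[OF l k(2) i(1)] i by (simp add: \<beta>_def)
      ultimately show ?thesis by (simp add: f_def)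
    qed
    then have "(\<Sum>i<n. f i) = (\<Sum>i<n. if i = n - 1 then f (n - 1) else 0)"
      by (intro sum.cong) auto
    also have "\<dots> = f (n - 1)" using n by simp
    also have "f (n - 1) = T (\<gamma>[0 := k'] @ [k])"
      using n k le Te by (simp add: f_def \<beta>_def K_def)
    finally show ?thesis
      using polar[OF l l\<beta>, of "e ! (n - 1)" k'] by (simp add: f_def sum.distrib)
  qed
  \<comment> \<open>Move the argument from \<open>K\<close> to the front and split the last argument along \<open>e\<close> and \<open>K\<close>.\<close>
  have kill: "T xs = 0" if l: "length xs = n" and i: "i < n" "xs ! i \<in> K" for xs i
  proof -
    have "xs ! i \<in> set xs" using l i by simp
    then obtain A where A: "mset xs = add_mset (xs ! i) A"
      using multi_member_split[of "xs ! i" "mset xs"] by auto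
    obtain r where r: "mset r = A" using ex_mset by blast
    have "length r = n - 1" using A r l by (metis length_Cons mset.simps(2) size_mset diff_Suc_1)
    then obtain \<gamma> x where \<gamma>: "r = \<gamma> @ [x]" using n by (cases r rule: rev_cases) auto
    have m: "mset xs = mset ((xs ! i # \<gamma>)[0 := xs ! i] @ [x])" using A r \<gamma> by simp
    have ls: "Suc (length (xs ! i # \<gamma>)) = n" using mset_eq_length[OF m] l by simp
    obtain c k where k: "k \<in> K" and x: "x = (\<Sum>l<n. c l *\<^sub>R e ! l) + k" using split by blast
    have lin: "linear (\<lambda>x. T ((xs ! i # \<gamma>)[0 := xs ! i] @ [x]))"
      using ls by (intro multivector_append_linear[OF T]) simp
    have "T ((xs ! i # \<gamma>)[0 := xs ! i] @ [x]) = 0"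
      unfolding x linear_add[OF lin] linear_sum[OF lin] linear_scale[OF lin]
      using ends_Ke[OF ls i(2)] ends_KK[OF ls k i(2)] by simp
    then show ?thesis using multivector_zero_mset[OF T _ m] mset_eq_length[OF m] l by simp
  qed
  define vs where "vs = map v [0..<n]"
  have lvs: "length vs = n" by (simp add: vs_def)
  have W: "is_multivector n (wedge vs)" by (rule is_multivector_wedge[OF lvs])
  have vsj: "blinfun_apply \<alpha> (vs ! j) = T (e[j := \<alpha>])" if "j < n" for \<alpha> j
    using that v by (simp add: vs_def)
  have "pairing_matrix vs e = 1\<^sub>m n"
    by (intro eq_matI) (auto simp: pairing_matrix_def lvs vsj T_e_update)
  then have We: "wedge vs e = 1" by (simp add: wedge_eq_det)
  have "T xs - wedge vs xs = 0" if xs: "length xs = n" for xs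
  proof (rule multivector_eq_0_if_frame[of n "\<lambda>xs. T xs - wedge vs xs" e K])
    show "is_multivector n (\<lambda>xs. T xs - wedge vs xs)"
      using T W unfolding is_multivector_def
      by (auto intro!: linear_compose_sub)
    fix xs :: "('m \<Rightarrow>\<^sub>L real) list" and i assume xs: "length xs = n" "i < n" "xs ! i \<in> K"
    have "wedge vs xs = wedge vs (xs[i := xs ! i])" by simp
    also have "\<dots> = 0" using xs unfolding wedge_update[OF lvs xs(1,2)] by (simp add: vsj K_def)
    finally show "T xs - wedge vs xs = 0" using kill[OF xs] by simp
  qed (use le de Te We split xs in auto)
  then show ?thesis using lvs by auto
qed

section \<open>Symmetry of second derivatives\<close>

lemma line_has_real_derivative:
  fixes f :: "'m::real_normed_vector \<Rightarrow> real"
  assumes "f differentiable (at (a + s *\<^sub>R u))"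
  shows "((\<lambda>s. f (a + s *\<^sub>R u)) has_real_derivative frechet_derivative f (at (a + s *\<^sub>R u)) u) (at s)"
proof -
  let ?D = "frechet_derivative f (at (a + s *\<^sub>R u))"
  have "((\<lambda>s. f (a + s *\<^sub>R u)) has_derivative (\<lambda>h. ?D (h *\<^sub>R u))) (at s)"
    by (rule has_derivative_compose[of "\<lambda>s. a + s *\<^sub>R u" "\<lambda>h. h *\<^sub>R u"])
       (use assms frechet_derivative_works in \<open>auto intro!: derivative_eq_intros\<close>)
  moreover have "?D (h *\<^sub>R u) = ?D u * h" for h
    using linear_scale[OF linear_frechet_derivative[OF assms]] by simp
  ultimately show ?thesis by (simp add: has_field_derivative_def)
qed

text \<open>
  The mean value theorem is applied in direction \<open>u\<close> to the increment of \<open>f\<close> in direction \<open>v\<close>, then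
  in direction \<open>v\<close> to the derivative.  The second difference is symmetric in \<open>u\<close> and \<open>v\<close>, while the
  mixed derivative on the right is taken in a fixed order.
\<close>
lemma second_difference_mean_value:
  fixes f :: "'m::real_normed_vector \<Rightarrow> real"
  assumes d1: "\<And>x. f differentiable (at x)"
    and d2: "\<And>x. (\<lambda>x. frechet_derivative f (at x) u) differentiable (at x)"
    and t: "t > 0"
  shows "\<exists>\<xi> \<eta>. 0 < \<xi> \<and> \<xi> < t \<and> 0 < \<eta> \<and> \<eta> < t \<and>
    f (x + t *\<^sub>R v + t *\<^sub>R u) - f (x + t *\<^sub>R u) - f (x + t *\<^sub>R v) + f x =
    t * t * frechet_derivative (\<lambda>x. frechet_derivative f (at x) u) (at (x + \<xi> *\<^sub>R u + \<eta> *\<^sub>R v)) v"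
proof -
  let ?f' = "\<lambda>x. frechet_derivative f (at x) u"
  define \<phi> where "\<phi> s = f (x + t *\<^sub>R v + s *\<^sub>R u) - f (x + s *\<^sub>R u)" for s
  have "(\<phi> has_real_derivative ?f' (x + t *\<^sub>R v + s *\<^sub>R u) - ?f' (x + s *\<^sub>R u)) (at s)" for s
    unfolding \<phi>_def by (intro DERIV_diff line_has_real_derivative d1)
  note deriv = this
  obtain \<xi> where \<xi>: "0 < \<xi>" "\<xi> < t"
      "\<phi> t - \<phi> 0 = t * (?f' (x + t *\<^sub>R v + \<xi> *\<^sub>R u) - ?f' (x + \<xi> *\<^sub>R u))"
    using MVT2[OF t deriv] by auto
  have "((\<lambda>s. ?f' (x + \<xi> *\<^sub>R u + s *\<^sub>R v)) has_real_derivative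
      frechet_derivative ?f' (at (x + \<xi> *\<^sub>R u + s *\<^sub>R v)) v) (at s)" for s
    by (intro line_has_real_derivative d2)
  note deriv2 = this
  obtain \<eta> where \<eta>: "0 < \<eta>" "\<eta> < t" "?f' (x + \<xi> *\<^sub>R u + t *\<^sub>R v) - ?f' (x + \<xi> *\<^sub>R u + 0 *\<^sub>R v) =
      t * frechet_derivative ?f' (at (x + \<xi> *\<^sub>R u + \<eta> *\<^sub>R v)) v"
    using MVT2[OF t deriv2] by auto
  have "f (x + t *\<^sub>R v + t *\<^sub>R u) - f (x + t *\<^sub>R u) - f (x + t *\<^sub>R v) + f x = \<phi> t - \<phi> 0"
    by (simp add: \<phi>_def)
  also have "\<dots> = t * t * frechet_derivative ?f' (at (x + \<xi> *\<^sub>R u + \<eta> *\<^sub>R v)) v"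
    using \<xi>(3) \<eta>(3) by (simp add: add_ac)
  finally show ?thesis using \<xi> \<eta> by blast
qed

text \<open>
  Both mixed derivatives, at points that tend to \<open>x\<close>, are equal to the same second difference
  quotient; continuity then identifies them at \<open>x\<close>.
\<close>
lemma second_derivative_symmetric:
  fixes f :: "'m::real_normed_vector \<Rightarrow> real"
  assumes f: "C_k (Suc (Suc 0)) f"
  shows "frechet_derivative (\<lambda>x. frechet_derivative f (at x) u) (at x) v =
         frechet_derivative (\<lambda>x. frechet_derivative f (at x) v) (at x) u"
proof -
  define D where "D u v y = frechet_derivative (\<lambda>x. frechet_derivative f (at x) u) (at y) v" for u v y
  have d1: "f differentiable (at x)" for x using f by simp
  have d2: "(\<lambda>x. frechet_derivative f (at x) u) differentiable (at x)" for u x using f by simp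
  have cont: "isCont (D u v) y" for u v y
    using f by (simp add: D_def[abs_def] continuous_on_eq_continuous_at)
  define t where "t i = inverse (real (Suc i))" for i
  have t0: "t i > 0" for i by (simp add: t_def)
  have t: "t \<longlonglongrightarrow> 0" unfolding t_def by (rule LIMSEQ_inverse_real_of_nat)
  have lim: "\<exists>y. (\<forall>i. f (x + t i *\<^sub>R v + t i *\<^sub>R u) - f (x + t i *\<^sub>R u) - f (x + t i *\<^sub>R v) + f x =
      t i * t i * D u v (y i)) \<and> (\<lambda>i. D u v (y i)) \<longlonglongrightarrow> D u v x" for u v
  proof -
    obtain \<xi> \<eta> where *: "\<And>i. 0 < \<xi> i \<and> \<xi> i < t i \<and> 0 < \<eta> i \<and> \<eta> i < t i \<and>
        f (x + t i *\<^sub>R v + t i *\<^sub>R u) - f (x + t i *\<^sub>R u) - f (x + t i *\<^sub>R v) + f x =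
        t i * t i * D u v (x + \<xi> i *\<^sub>R u + \<eta> i *\<^sub>R v)"
      using second_difference_mean_value[OF d1 d2 t0, where u = u and v = v and x = x] unfolding D_def by metis
    have "\<xi> \<longlonglongrightarrow> 0" "\<eta> \<longlonglongrightarrow> 0"
      using * by (auto intro!: tendsto_sandwich[OF _ _ tendsto_const t] always_eventually less_imp_le)
    then have "(\<lambda>i. x + \<xi> i *\<^sub>R u + \<eta> i *\<^sub>R v) \<longlonglongrightarrow> x + 0 *\<^sub>R u + 0 *\<^sub>R v"
      by (intro tendsto_intros)
    then have "(\<lambda>i. D u v (x + \<xi> i *\<^sub>R u + \<eta> i *\<^sub>R v)) \<longlonglongrightarrow> D u v x"
      by (intro isCont_tendsto_compose[OF cont]) simp
    with * show ?thesis
      by (intro exI[of _ "\<lambda>i. x + \<xi> i *\<^sub>R u + \<eta> i *\<^sub>R v"]) blast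
  qed
  obtain y where y: "\<And>i. f (x + t i *\<^sub>R v + t i *\<^sub>R u) - f (x + t i *\<^sub>R u) - f (x + t i *\<^sub>R v) + f x =
      t i * t i * D u v (y i)" "(\<lambda>i. D u v (y i)) \<longlonglongrightarrow> D u v x"
    using lim by blast
  obtain z where z: "\<And>i. f (x + t i *\<^sub>R u + t i *\<^sub>R v) - f (x + t i *\<^sub>R v) - f (x + t i *\<^sub>R u) + f x =
      t i * t i * D v u (z i)" "(\<lambda>i. D v u (z i)) \<longlonglongrightarrow> D v u x"
    using lim by blast
  have "D u v (y i) = D v u (z i)" for i
  proof -
    have "t i * t i * D u v (y i) = t i * t i * D v u (z i)"
      unfolding y(1)[symmetric] z(1)[symmetric] by (simp add: algebra_simps)
    then show ?thesis using t0[of i] by simp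
  qed
  then have "(\<lambda>i. D u v (y i)) \<longlonglongrightarrow> D v u x" using z(2) by simp
  then have "D u v x = D v u x" by (rule LIMSEQ_unique[OF y(2)])
  then show ?thesis by (simp add: D_def)
qed

section \<open>Smooth test functions and Hessians\<close>

lemma frechet_derivative_eqI:
  "(f has_derivative f') (at x) \<Longrightarrow> frechet_derivative f (at x) = f'"
  using frechet_derivative_at by metis

lemma differential_eqI:
  "(f has_derivative f') (at x) \<Longrightarrow> differential f x = Blinfun f'"
  by (simp add: differential_def frechet_derivative_eqI)

lemma differential_apply:
  "f differentiable (at x) \<Longrightarrow> blinfun_apply (differential f x) = frechet_derivative f (at x)"
  unfolding differential_def
  by (intro bounded_linear_Blinfun_apply) (simp add: frechet_derivative_works has_derivative_bounded_linear)

lemma blinfun_has_derivative: "(blinfun_apply \<alpha> has_derivative blinfun_apply \<alpha>) (at x)"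
  by (rule bounded_linear_imp_has_derivative) (rule blinfun.bounded_linear_right)

lemma differential_blinfun: "differential (blinfun_apply \<alpha>) x = \<alpha>"
  by (simp add: differential_eqI[OF blinfun_has_derivative] blinfun_apply_inverse)

lemma C_k_const: "C_k k (\<lambda>x::'m::real_normed_vector. c)"
  by (induction k arbitrary: c) auto

lemma C_k_blinfun: "C_k k (blinfun_apply \<alpha>)"
proof (cases k)
  case (Suc k')
  show ?thesis unfolding Suc
    using blinfun_has_derivative[of \<alpha>]
    by (auto simp: frechet_derivative_eqI[OF blinfun_has_derivative] C_k_const differentiable_def)
qed (auto intro!: continuous_intros)

lemma smooth_blinfun: "smooth (blinfun_apply \<alpha>)"
  by (simp add: smooth_def C_k_blinfun)

lemma has_derivative_square:
  fixes \<alpha> :: "'m::real_normed_vector \<Rightarrow>\<^sub>L real"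
  shows "((\<lambda>x. (blinfun_apply \<alpha> x)\<^sup>2) has_derivative
    (\<lambda>h. 2 * blinfun_apply \<alpha> x * blinfun_apply \<alpha> h)) (at x)"
  by (auto intro!: derivative_eq_intros simp: algebra_simps)

lemma smooth_square: "smooth (\<lambda>x. (blinfun_apply \<alpha> x)\<^sup>2)"
  unfolding smooth_def
proof
  fix k show "C_k k (\<lambda>x. (blinfun_apply \<alpha> x)\<^sup>2)"
  proof (cases k)
    case (Suc k')
    have "C_k k' (blinfun_apply ((2 * blinfun_apply \<alpha> v) *\<^sub>R \<alpha>))" for v
      by (rule C_k_blinfun)
    moreover have "blinfun_apply ((2 * blinfun_apply \<alpha> v) *\<^sub>R \<alpha>) =
        (\<lambda>x. 2 * blinfun_apply \<alpha> x * blinfun_apply \<alpha> v)" for v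
      by (auto simp: blinfun.scaleR_left algebra_simps)
    ultimately have "C_k k' (\<lambda>x. 2 * blinfun_apply \<alpha> x * blinfun_apply \<alpha> v)" for v
      by metis
    then show ?thesis unfolding Suc
      using has_derivative_square[of \<alpha>]
      by (auto simp: frechet_derivative_eqI[OF has_derivative_square] differentiable_def)
  qed (auto intro!: continuous_intros)
qed

lemma smooth_imp_C2: "smooth f \<Longrightarrow> C_k (Suc (Suc 0)) f"
  by (simp add: smooth_def del: C_k.simps)

lemma smooth_differentiable: "smooth f \<Longrightarrow> f differentiable (at x)"
  using smooth_imp_C2[of f] by simp

lemma smooth_differentiable2:
  "smooth f \<Longrightarrow> (\<lambda>x. frechet_derivative f (at x) v) differentiable (at x)"
  using smooth_imp_C2[of f] by simp

text \<open>
  The Hessian is stored as a map from vectors to covectors, so that its values can be inserted into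
  multivectors: \<open>hessian f p h\<close> is the derivative in direction \<open>h\<close> of the differential of \<open>f\<close>.
\<close>
definition hessian :: "('m::real_normed_vector \<Rightarrow> real) \<Rightarrow> 'm \<Rightarrow> 'm \<Rightarrow> ('m \<Rightarrow>\<^sub>L real)" where
  "hessian f p h = Blinfun (\<lambda>v. frechet_derivative (\<lambda>q. frechet_derivative f (at q) v) (at p) h)"

lemma hessian_blinfun: "hessian (blinfun_apply \<alpha>) p h = 0"
  by (simp add: hessian_def frechet_derivative_eqI[OF blinfun_has_derivative] zero_blinfun_def)

text \<open>
  These Hessians, of rank at most one, are the test cases that produce the quadratic relation.
\<close>
lemma hessian_square:
  "hessian (\<lambda>x. (blinfun_apply \<alpha> x)\<^sup>2) p h = (2 * blinfun_apply \<alpha> h) *\<^sub>R \<alpha>"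
proof -
  have *: "((\<lambda>x. 2 * blinfun_apply \<alpha> x * blinfun_apply \<alpha> v) has_derivative
      (\<lambda>h. 2 * blinfun_apply \<alpha> h * blinfun_apply \<alpha> v)) (at p)" for v
    by (auto intro!: derivative_eq_intros)
  have "hessian (\<lambda>x. (blinfun_apply \<alpha> x)\<^sup>2) p h =
      Blinfun (blinfun_apply ((2 * blinfun_apply \<alpha> h) *\<^sub>R \<alpha>))"
    unfolding hessian_def frechet_derivative_eqI[OF has_derivative_square] frechet_derivative_eqI[OF *]
    by (rule arg_cong[where f = Blinfun], rule ext) (simp add: blinfun.scaleR_left)
  then show ?thesis by (simp add: blinfun_apply_inverse)
qed

section \<open>Finite frames\<close>

text \<open>
  The dual of a finite-dimensional space has a frame whose covectors are evaluations at vectors.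
  The induction removes a point \<open>b\<close> from \<open>B\<close> by passing to the functionals that vanish at \<open>b\<close>; a
  functional with value 1 at \<open>b\<close> completes the frame.
\<close>
lemma dual_frame_on_subspace:
  fixes S :: "'v::real_normed_vector dual set"
  assumes "finite B" "subspace S" "\<And>\<phi>. \<phi> \<in> S \<Longrightarrow> (\<forall>b\<in>B. blinfun_apply \<phi> b = 0) \<Longrightarrow> \<phi> = 0"
  shows "\<exists>m v w. \<forall>\<phi>\<in>S. \<phi> = (\<Sum>k<(m::nat). blinfun_apply \<phi> (v k) *\<^sub>R w k)"
  using assms
proof (induction B arbitrary: S rule: finite_induct)
  case empty
  then have "\<forall>\<phi>\<in>S. \<phi> = 0" by blast
  then show ?case by (intro exI[of _ 0]) auto
next
  case (insert b B)
  let ?S = "S \<inter> {\<phi>. blinfun_apply \<phi> b = 0}"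
  have "subspace ?S"
    using insert.prems(1) by (auto simp: subspace_def blinfun.add_left blinfun.scaleR_left)
  moreover have "\<phi> = 0" if "\<phi> \<in> ?S" "\<forall>b\<in>B. blinfun_apply \<phi> b = 0" for \<phi>
    using insert.prems(2)[of \<phi>] that by auto
  ultimately obtain m v w where
    IH: "\<And>\<phi>. \<phi> \<in> ?S \<Longrightarrow> \<phi> = (\<Sum>k<(m::nat). blinfun_apply \<phi> (v k) *\<^sub>R w k)"
    using insert.IH[of ?S] by blast
  show ?case
  proof (cases "\<exists>\<phi>\<in>S. blinfun_apply \<phi> b \<noteq> 0")
    case False
    then show ?thesis using IH by (intro exI[of _ m] exI[of _ v] exI[of _ w]) blast
  next
    case True
    then obtain \<psi> where \<psi>: "\<psi> \<in> S" "blinfun_apply \<psi> b \<noteq> 0" by blast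
    define \<phi>0 where "\<phi>0 = (1 / blinfun_apply \<psi> b) *\<^sub>R \<psi>"
    have \<phi>0: "\<phi>0 \<in> S" "blinfun_apply \<phi>0 b = 1"
      using \<psi> insert.prems(1) by (auto simp: \<phi>0_def subspace_scale blinfun.scaleR_left)
    define v' where "v' k = (if k < m then v k - blinfun_apply \<phi>0 (v k) *\<^sub>R b else b)" for k
    define w' where "w' k = (if k < m then w k else \<phi>0)" for k
    have "\<phi> = (\<Sum>k<Suc m. blinfun_apply \<phi> (v' k) *\<^sub>R w' k)" if \<phi>: "\<phi> \<in> S" for \<phi>
    proof -
      let ?\<chi> = "\<phi> - blinfun_apply \<phi> b *\<^sub>R \<phi>0"
      have "?\<chi> \<in> ?S"
        using \<phi> \<phi>0 insert.prems(1)
        by (auto simp: subspace_diff subspace_scale blinfun.diff_left blinfun.scaleR_left)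
      then have "?\<chi> = (\<Sum>k<m. blinfun_apply ?\<chi> (v k) *\<^sub>R w k)" by (rule IH)
      also have "\<dots> = (\<Sum>k<m. blinfun_apply \<phi> (v' k) *\<^sub>R w' k)"
        by (intro sum.cong refl)
           (auto simp: v'_def w'_def blinfun.diff_left blinfun.scaleR_left blinfun.diff_right
             blinfun.scaleR_right mult.commute)
      finally have "\<phi> = (\<Sum>k<m. blinfun_apply \<phi> (v' k) *\<^sub>R w' k) + blinfun_apply \<phi> b *\<^sub>R \<phi>0"
        by (metis diff_add_cancel)
      then show ?thesis by (simp add: v'_def w'_def)
    qed
    then show ?thesis by blast
  qed
qed

locale finite_frame =
  fixes m :: nat and e :: "nat \<Rightarrow> ('m::real_normed_vector \<Rightarrow>\<^sub>L real)" and w :: "nat \<Rightarrow> 'm"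
  assumes frame: "x = (\<Sum>k<m. blinfun_apply (e k) x *\<^sub>R w k)"
begin

lemma linear_expand:
  fixes L :: "'m \<Rightarrow> real"
  assumes "linear L"
  shows "L x = (\<Sum>k<m. L (w k) * blinfun_apply (e k) x)"
proof -
  have "L x = L (\<Sum>k<m. blinfun_apply (e k) x *\<^sub>R w k)"
    by (rule arg_cong[OF frame])
  then show ?thesis
    by (simp add: linear_sum[OF assms] linear_scale[OF assms] mult.commute)
qed

lemma Blinfun_linear:
  fixes L :: "'m \<Rightarrow> real"
  assumes "linear L"
  shows "blinfun_apply (Blinfun L) = L"
proof (rule bounded_linear_Blinfun_apply)
  have "L = (\<lambda>x. \<Sum>k<m. L (w k) * blinfun_apply (e k) x)"
    by (rule ext) (rule linear_expand[OF assms])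
  moreover have "bounded_linear (\<lambda>x. \<Sum>k<m. L (w k) * blinfun_apply (e k) x)"
    by (intro bounded_linear_intros)
  ultimately show "bounded_linear L" by simp
qed

lemma covector_expand: "\<alpha> = (\<Sum>k<m. blinfun_apply \<alpha> (w k) *\<^sub>R e k)"
proof (rule blinfun_eqI)
  fix x
  have "linear (blinfun_apply \<alpha>)"
    by (rule bounded_linear.linear[OF blinfun.bounded_linear_right])
  from linear_expand[OF this, of x]
  show "blinfun_apply \<alpha> x = blinfun_apply (\<Sum>k<m. blinfun_apply \<alpha> (w k) *\<^sub>R e k) x"
    by (simp only: blinfun.sum_left blinfun.scaleR_left real_scaleR_def)
qed

text \<open>
  Every linear functional on the covectors is evaluation at a vector.  In this way a contraction of
  a multivector with all but one of its arguments becomes a vector.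
\<close>
lemma reflexive:
  fixes L :: "('m \<Rightarrow>\<^sub>L real) \<Rightarrow> real"
  assumes "linear L"
  shows "\<exists>x. \<forall>\<alpha>. L \<alpha> = blinfun_apply \<alpha> x"
proof (intro exI allI)
  fix \<alpha>
  have "L \<alpha> = L (\<Sum>k<m. blinfun_apply \<alpha> (w k) *\<^sub>R e k)"
    by (rule arg_cong[OF covector_expand])
  then show "L \<alpha> = blinfun_apply \<alpha> (\<Sum>k<m. L (e k) *\<^sub>R w k)"
    by (simp add: linear_sum[OF assms] linear_scale[OF assms] blinfun.sum_right
        blinfun.scaleR_right mult.commute)
qed

lemma hessian_linear_arg:
  fixes f :: "'m \<Rightarrow> real"
  assumes "smooth f"
  shows "linear (\<lambda>v. frechet_derivative (\<lambda>q. frechet_derivative f (at q) v) (at p) h)"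
proof -
  note d2 = smooth_differentiable2[OF assms, of _ p, unfolded frechet_derivative_works]
  note lin = linear_frechet_derivative[OF smooth_differentiable[OF assms]]
  show ?thesis
  proof (rule linearI)
    fix u v and c :: real
    show "frechet_derivative (\<lambda>q. frechet_derivative f (at q) (u + v)) (at p) h =
        frechet_derivative (\<lambda>q. frechet_derivative f (at q) u) (at p) h +
        frechet_derivative (\<lambda>q. frechet_derivative f (at q) v) (at p) h"
      using frechet_derivative_eqI[OF has_derivative_add[OF d2[of u] d2[of v]]]
      by (simp add: linear_add[OF lin])
    show "frechet_derivative (\<lambda>q. frechet_derivative f (at q) (c *\<^sub>R v)) (at p) h =
        c *\<^sub>R frechet_derivative (\<lambda>q. frechet_derivative f (at q) v) (at p) h"
      using frechet_derivative_eqI[OF has_derivative_scaleR_right[OF d2[of v], of c]]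
      by (simp add: linear_scale[OF lin])
  qed
qed

lemma hessian_apply:
  fixes f :: "'m \<Rightarrow> real"
  assumes "smooth f"
  shows "blinfun_apply (hessian f p h) v =
    frechet_derivative (\<lambda>q. frechet_derivative f (at q) v) (at p) h"
  by (simp add: hessian_def Blinfun_linear[OF hessian_linear_arg[OF assms]])

lemma hessian_symmetric:
  fixes f :: "'m \<Rightarrow> real"
  assumes "smooth f"
  shows "blinfun_apply (hessian f p h) v = blinfun_apply (hessian f p v) h"
  unfolding hessian_apply[OF assms]
  by (rule second_derivative_symmetric[OF smooth_imp_C2[OF assms]])

lemma hessian_linear:
  fixes f :: "'m \<Rightarrow> real"
  assumes "smooth f"
  shows "linear (hessian f p)"
proof (rule linearI; rule blinfun_eqI)
  fix u v x and c :: real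
  note sym = hessian_symmetric[OF assms, of p _ x]
  show "blinfun_apply (hessian f p (u + v)) x = blinfun_apply (hessian f p u + hessian f p v) x"
    unfolding blinfun.add_left sym by (rule blinfun.add_right)
  show "blinfun_apply (hessian f p (c *\<^sub>R v)) x = blinfun_apply (c *\<^sub>R hessian f p v) x"
    unfolding blinfun.scaleR_left sym by (rule blinfun.scaleR_right)
qed

end

section \<open>The derivative of a bracket\<close>

locale linear_field_on_frame = finite_frame m e w
  for m :: nat and e :: "nat \<Rightarrow> ('m::real_normed_vector \<Rightarrow>\<^sub>L real)" and w :: "nat \<Rightarrow> 'm" +
  fixes n :: nat and \<Lambda> :: "'m multivector_field"
  assumes multivector: "is_multivector n (\<Lambda> p)"
    and linear_in_point: "length \<alpha>s = n \<Longrightarrow> linear (\<lambda>p. \<Lambda> p \<alpha>s)"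
begin

lemma slot_linear:
  assumes "length \<xi> + Suc (length \<beta>) = n"
  shows "linear (\<lambda>\<alpha>. \<Lambda> p (\<xi> @ \<alpha> # \<beta>))"
  using multivector_linear[OF multivector, of "\<xi> @ 0 # \<beta>" "length \<xi>" p] assms by simp

lemma slot_expand:
  assumes "length \<xi> + Suc (length \<beta>) = n"
  shows "\<Lambda> p (\<xi> @ \<alpha> # \<beta>) = (\<Sum>k<m. blinfun_apply \<alpha> (w k) * \<Lambda> p (\<xi> @ e k # \<beta>))"
proof -
  have "\<Lambda> p (\<xi> @ \<alpha> # \<beta>) = \<Lambda> p (\<xi> @ (\<Sum>k<m. blinfun_apply \<alpha> (w k) *\<^sub>R e k) # \<beta>)"
    by (rule arg_cong[where f = "\<lambda>\<alpha>. \<Lambda> p (\<xi> @ \<alpha> # \<beta>)", OF covector_expand])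
  then show ?thesis
    by (simp add: linear_sum[OF slot_linear[OF assms]] linear_scale[OF slot_linear[OF assms]])
qed

text \<open>
  The product rule.  As \<open>\<Lambda>\<close> is linear in the point, its derivative in direction \<open>h\<close> is its value at
  \<open>h\<close>.  The induction runs over the number of arguments that vary with the point, the remaining
  ones being constant; the frame turns the last varying argument into a sum of products of a scalar
  function and a form with one more constant argument.
\<close>
lemma has_derivative_along_differentials:
  assumes "\<And>g. g \<in> set gs \<Longrightarrow> smooth g" "length gs + length \<beta> = n"
  shows "((\<lambda>q. \<Lambda> q (map (\<lambda>g. differential g q) gs @ \<beta>)) has_derivative
    (\<lambda>h. \<Lambda> h (map (\<lambda>g. differential g p) gs @ \<beta>) +
      (\<Sum>i<length gs. \<Lambda> p ((map (\<lambda>g. differential g p) gs)[i := hessian (gs ! i) p h] @ \<beta>)))) (at p)"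
  using assms
proof (induction gs arbitrary: \<beta> rule: rev_induct)
  case Nil
  have "bounded_linear (\<lambda>q. \<Lambda> q \<beta>)"
    using blinfun.bounded_linear_right[of "Blinfun (\<lambda>q. \<Lambda> q \<beta>)"]
      Blinfun_linear[OF linear_in_point, of \<beta>] Nil by simp
  then show ?case by (simp add: bounded_linear_imp_has_derivative)
next
  case (snoc g gs)
  let ?D = "\<lambda>q. map (\<lambda>g. differential g q) gs"
  have len: "length gs + Suc (length \<beta>) = n" using snoc by simp
  have g: "smooth g" using snoc by simp
  have IH: "((\<lambda>q. \<Lambda> q (?D q @ e k # \<beta>)) has_derivative
      (\<lambda>h. \<Lambda> h (?D p @ e k # \<beta>) + (\<Sum>i<length gs. \<Lambda> p ((?D p)[i := hessian (gs ! i) p h] @ e k # \<beta>)))) (at p)" for k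
    using snoc.prems len by (intro snoc.IH) auto
  have dg: "((\<lambda>q. frechet_derivative g (at q) v) has_derivative
      (\<lambda>h. blinfun_apply (hessian g p h) v)) (at p)" for v
    using smooth_differentiable2[OF g, of v p] unfolding hessian_apply[OF g] frechet_derivative_works .
  have expand: "\<Lambda> q (?D q @ differential g q # \<beta>) =
      (\<Sum>k<m. frechet_derivative g (at q) (w k) * \<Lambda> q (?D q @ e k # \<beta>))" for q
    using len by (subst slot_expand) (auto simp: differential_apply[OF smooth_differentiable[OF g]])
  have "((\<lambda>q. \<Lambda> q (?D q @ differential g q # \<beta>)) has_derivative
      (\<lambda>h. \<Sum>k<m. frechet_derivative g (at p) (w k) * (\<Lambda> h (?D p @ e k # \<beta>) +
          (\<Sum>i<length gs. \<Lambda> p ((?D p)[i := hessian (gs ! i) p h] @ e k # \<beta>))) +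
        blinfun_apply (hessian g p h) (w k) * \<Lambda> p (?D p @ e k # \<beta>))) (at p)"
    unfolding expand by (intro has_derivative_sum has_derivative_mult IH dg)
  moreover have "(\<Sum>k<m. frechet_derivative g (at p) (w k) * (\<Lambda> h (?D p @ e k # \<beta>) +
          (\<Sum>i<length gs. \<Lambda> p ((?D p)[i := hessian (gs ! i) p h] @ e k # \<beta>))) +
        blinfun_apply (hessian g p h) (w k) * \<Lambda> p (?D p @ e k # \<beta>)) =
      \<Lambda> h (?D p @ differential g p # \<beta>) +
      ((\<Sum>i<length gs. \<Lambda> p ((?D p)[i := hessian (gs ! i) p h] @ differential g p # \<beta>)) +
      \<Lambda> p (?D p @ hessian g p h # \<beta>))" (is "?L = ?R") for h
  proof -
    have dg: "\<Lambda> q (\<xi> @ differential g p # \<beta>) =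
        (\<Sum>k<m. frechet_derivative g (at p) (w k) * \<Lambda> q (\<xi> @ e k # \<beta>))"
      if "length \<xi> = length gs" for q \<xi>
      unfolding differential_apply[OF smooth_differentiable[OF g], symmetric]
      using that len by (intro slot_expand) simp
    have "?R = (\<Sum>k<m. frechet_derivative g (at p) (w k) * \<Lambda> h (?D p @ e k # \<beta>)) +
      ((\<Sum>i<length gs. \<Sum>k<m. frechet_derivative g (at p) (w k) *
          \<Lambda> p ((?D p)[i := hessian (gs ! i) p h] @ e k # \<beta>)) +
      (\<Sum>k<m. blinfun_apply (hessian g p h) (w k) * \<Lambda> p (?D p @ e k # \<beta>)))"
      using len by (intro arg_cong2[where f = "(+)"] sum.cong refl dg slot_expand) simp_all
    also have "\<dots> = ?L"
      by (subst sum.swap) (simp add: sum.distrib sum_distrib_left distrib_left)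
    finally show ?thesis by simp
  qed
  moreover have "(\<Sum>i<length (gs @ [g]). \<Lambda> p ((map (\<lambda>g. differential g p) (gs @ [g]))
        [i := hessian ((gs @ [g]) ! i) p h] @ \<beta>)) =
      (\<Sum>i<length gs. \<Lambda> p ((?D p)[i := hessian (gs ! i) p h] @ differential g p # \<beta>)) +
      \<Lambda> p (?D p @ hessian g p h # \<beta>)" for h
    by (simp add: list_update_append nth_append)
  ultimately show ?case by simp
qed

lemma bracket_has_derivative:
  assumes "\<And>g. g \<in> set gs \<Longrightarrow> smooth g" "length gs = n"
  shows "(bracket \<Lambda> gs has_derivative
    (\<lambda>h. \<Lambda> h (map (\<lambda>g. differential g p) gs) +
      (\<Sum>i<n. \<Lambda> p ((map (\<lambda>g. differential g p) gs)[i := hessian (gs ! i) p h])))) (at p)"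
  using has_derivative_along_differentials[of gs "[]" p] assms by (simp add: bracket_def[abs_def])

end

section \<open>The defect of the Filippov identity\<close>

context linear_field_on_frame
begin

definition point_derivative :: "('m \<Rightarrow>\<^sub>L real) list \<Rightarrow> ('m \<Rightarrow>\<^sub>L real)" where
  "point_derivative \<alpha>s = Blinfun (\<lambda>h. \<Lambda> h \<alpha>s)"

lemma point_derivative_apply:
  "length \<alpha>s = n \<Longrightarrow> blinfun_apply (point_derivative \<alpha>s) h = \<Lambda> h \<alpha>s"
  unfolding point_derivative_def by (subst Blinfun_linear[OF linear_in_point]) auto

text \<open>
  The part of the defect that comes from differentiating the coefficients of \<open>\<Lambda>\<close>.  Its
  first term is \<open>\<Lambda> X \<beta>\<close>, the derivative of \<open>\<Lambda>\<close> along the vector \<open>X\<close> that represents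
  \<open>\<alpha> \<mapsto> \<Lambda> p (\<gamma> @ [\<alpha>])\<close>.
\<close>
definition first_order_defect :: "'m \<Rightarrow> ('m \<Rightarrow>\<^sub>L real) list \<Rightarrow> ('m \<Rightarrow>\<^sub>L real) list \<Rightarrow> real" where
  "first_order_defect p \<gamma> \<beta> = \<Lambda> p (\<gamma> @ [point_derivative \<beta>]) -
     (\<Sum>i<n. \<Lambda> p (\<beta>[i := point_derivative (\<gamma> @ [\<beta> ! i])]))"

text \<open>
  The part of the defect that comes from the second derivatives of the function \<open>f\<close> standing in
  position \<open>j\<close> of the first group of arguments.
\<close>
definition second_order_defect ::
    "('m \<Rightarrow> real) \<Rightarrow> nat \<Rightarrow> 'm \<Rightarrow> ('m \<Rightarrow>\<^sub>L real) list \<Rightarrow> ('m \<Rightarrow>\<^sub>L real) list \<Rightarrow> real" where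
  "second_order_defect f j p \<gamma> \<beta> =
     (\<Sum>i<n. \<Lambda> p (\<beta>[i := Blinfun (\<lambda>h. \<Lambda> p (\<gamma>[j := hessian f p h] @ [\<beta> ! i]))]))"

lemma linear_hessian_slot:
  assumes "smooth f" "length \<alpha>s = n" "i < n"
  shows "linear (\<lambda>h. \<Lambda> p (\<alpha>s[i := hessian f p h]))"
  using linear_compose[OF hessian_linear[OF assms(1), of p]
      multivector_linear[OF multivector assms(2,3), of p]]
  by (simp add: o_def)

lemma linear_hessian_inner_slot:
  assumes "smooth f" "Suc (length \<gamma>) = n" "j < length \<gamma>"
  shows "linear (\<lambda>h. \<Lambda> p (\<gamma>[j := hessian f p h] @ [\<delta>]))"
  using linear_hessian_slot[OF assms(1), of "\<gamma> @ [\<delta>]" j p] assms(2,3)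
  by (simp add: list_update_append)

lemma differential_bracket_apply:
  assumes "\<And>g. g \<in> set gs \<Longrightarrow> smooth g" "length gs = n"
  shows "blinfun_apply (differential (bracket \<Lambda> gs) p) h = \<Lambda> h (map (\<lambda>g. differential g p) gs) +
      (\<Sum>i<n. \<Lambda> p ((map (\<lambda>g. differential g p) gs)[i := hessian (gs ! i) p h]))"
  using differentiableI[OF bracket_has_derivative[OF assms]]
    frechet_derivative_eqI[OF bracket_has_derivative[OF assms]]
  by (simp add: differential_apply)

text \<open>
  The product rule is applied to both sides.  With \<open>X\<close> representing \<open>\<alpha> \<mapsto> \<Lambda> p (\<gamma> @ [\<alpha>])\<close>, the
  left-hand side is the derivative of the inner bracket in direction \<open>X\<close>.  The Hessian of \<open>g\<^sub>i\<close> enters it at \<open>X\<close>; in the right-hand side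
  it enters through \<open>h \<mapsto> \<Lambda> p (\<gamma> @ [H h])\<close>, which is \<open>h \<mapsto> (H h) X = (H X) h\<close>.
\<close>
lemma filippov_defect:
  fixes fs gs :: "('m \<Rightarrow> real) list" and p :: 'm
  assumes fs: "\<And>f. f \<in> set fs \<Longrightarrow> smooth f" "Suc (length fs) = n"
    and gs: "\<And>g. g \<in> set gs \<Longrightarrow> smooth g" "length gs = n"
  defines "\<gamma> \<equiv> map (\<lambda>f. differential f p) fs" and "\<beta> \<equiv> map (\<lambda>g. differential g p) gs"
  shows "bracket \<Lambda> (fs @ [bracket \<Lambda> gs]) p -
      (\<Sum>i<n. bracket \<Lambda> (gs[i := bracket \<Lambda> (fs @ [gs ! i])]) p) =
    first_order_defect p \<gamma> \<beta> - (\<Sum>j<length fs. second_order_defect (fs ! j) j p \<gamma> \<beta>)"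
proof -
  have l\<gamma>: "Suc (length \<gamma>) = n" and l\<beta>: "length \<beta> = n"
    using fs gs by (simp_all add: \<gamma>_def \<beta>_def)
  have fsj: "smooth (fs ! j)" if "j < length fs" for j using fs(1) that by simp
  have gsi: "smooth (gs ! i)" if "i < n" for i using gs that by simp
  obtain X where X: "\<And>\<alpha>. \<Lambda> p (\<gamma> @ [\<alpha>]) = blinfun_apply \<alpha> X"
    using reflexive[OF multivector_append_linear[OF multivector l\<gamma>]] by blast
  have lhs: "bracket \<Lambda> (fs @ [bracket \<Lambda> gs]) p =
      \<Lambda> X \<beta> + (\<Sum>i<n. \<Lambda> p (\<beta>[i := hessian (gs ! i) p X]))"
  proof -
    have "bracket \<Lambda> (fs @ [bracket \<Lambda> gs]) p = \<Lambda> p (\<gamma> @ [differential (bracket \<Lambda> gs) p])"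
      by (simp add: bracket_def[of _ "fs @ _"] \<gamma>_def)
    then show ?thesis
      unfolding X \<beta>_def by (simp add: differential_bracket_apply[OF gs])
  qed
  define K where "K j i = Blinfun (\<lambda>h. \<Lambda> p (\<gamma>[j := hessian (fs ! j) p h] @ [\<beta> ! i]))" for j i
  have inner: "differential (bracket \<Lambda> (fs @ [gs ! i])) p =
      point_derivative (\<gamma> @ [\<beta> ! i]) + (\<Sum>j<length fs. K j i) + hessian (gs ! i) p X"
    if i: "i < n" for i
  proof (rule blinfun_eqI)
    fix h
    have \<beta>i: "differential (gs ! i) p = \<beta> ! i" using i gs by (simp add: \<beta>_def)
    have Kh: "blinfun_apply (K j i) h = \<Lambda> p (\<gamma>[j := hessian (fs ! j) p h] @ [\<beta> ! i])"
      if "j < length fs" for j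
      unfolding K_def using that fs(2) l\<gamma>
      by (subst Blinfun_linear[OF linear_hessian_inner_slot[OF fsj l\<gamma>]]) auto
    have sm: "\<And>f. f \<in> set (fs @ [gs ! i]) \<Longrightarrow> smooth f" using fs(1) gsi[OF i] by auto
    have "blinfun_apply (differential (bracket \<Lambda> (fs @ [gs ! i])) p) h = \<Lambda> h (\<gamma> @ [\<beta> ! i]) +
        (\<Sum>j<Suc (length fs). \<Lambda> p ((\<gamma> @ [\<beta> ! i])[j := hessian ((fs @ [gs ! i]) ! j) p h]))"
      using differential_bracket_apply[where gs = "fs @ [gs ! i]" and p = p and h = h, OF sm] fs(2) by (simp add: \<gamma>_def \<beta>i)
    also have "(\<Sum>j<Suc (length fs). \<Lambda> p ((\<gamma> @ [\<beta> ! i])[j := hessian ((fs @ [gs ! i]) ! j) p h])) =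
        (\<Sum>j<length fs. \<Lambda> p (\<gamma>[j := hessian (fs ! j) p h] @ [\<beta> ! i])) +
        \<Lambda> p (\<gamma> @ [hessian (gs ! i) p h])"
      by (simp add: \<gamma>_def list_update_append nth_append)
    also have "\<Lambda> p (\<gamma> @ [hessian (gs ! i) p h]) = blinfun_apply (hessian (gs ! i) p X) h"
      unfolding X by (rule hessian_symmetric[OF gsi[OF i]])
    finally show "blinfun_apply (differential (bracket \<Lambda> (fs @ [gs ! i])) p) h =
        blinfun_apply (point_derivative (\<gamma> @ [\<beta> ! i]) + (\<Sum>j<length fs. K j i) +
          hessian (gs ! i) p X) h"
      using l\<gamma> by (simp add: blinfun.add_left blinfun.sum_left point_derivative_apply Kh)
  qed
  have rhs: "bracket \<Lambda> (gs[i := bracket \<Lambda> (fs @ [gs ! i])]) p =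
      \<Lambda> p (\<beta>[i := point_derivative (\<gamma> @ [\<beta> ! i])]) + (\<Sum>j<length fs. \<Lambda> p (\<beta>[i := K j i])) +
      \<Lambda> p (\<beta>[i := hessian (gs ! i) p X])" if i: "i < n" for i
  proof -
    have "bracket \<Lambda> (gs[i := bracket \<Lambda> (fs @ [gs ! i])]) p =
        \<Lambda> p (\<beta>[i := differential (bracket \<Lambda> (fs @ [gs ! i])) p])"
      by (simp add: bracket_def[of _ "_[_ := _]"] \<beta>_def map_update)
    then show ?thesis
      unfolding inner[OF i]
      by (simp add: linear_add[OF multivector_linear[OF multivector l\<beta> i]]
          linear_sum[OF multivector_linear[OF multivector l\<beta> i]])
  qed
  have "\<Lambda> X \<beta> = \<Lambda> p (\<gamma> @ [point_derivative \<beta>])"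
    unfolding X by (simp add: point_derivative_apply[OF l\<beta>])
  moreover have "(\<Sum>j<length fs. second_order_defect (fs ! j) j p \<gamma> \<beta>) =
      (\<Sum>i<n. \<Sum>j<length fs. \<Lambda> p (\<beta>[i := K j i]))"
    unfolding second_order_defect_def K_def by (rule sum.swap)
  ultimately show ?thesis
    unfolding lhs first_order_defect_def by (simp add: rhs sum.distrib)
qed

lemma second_order_defect_blinfun:
  assumes "Suc (length \<gamma>) = n" "length \<beta> = n" "j < length \<gamma>"
  shows "second_order_defect (blinfun_apply \<alpha>) j p \<gamma> \<beta> = 0"
proof -
  have "\<Lambda> p (\<gamma>[j := 0] @ [\<delta>]) = 0" for \<delta>
    using linear_0[OF multivector_linear[OF multivector, of "\<gamma> @ [\<delta>]" j p]] assms
    by (simp add: list_update_append)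
  moreover have "Blinfun (\<lambda>h::'m. 0 :: real) = 0" by (simp add: zero_blinfun_def)
  ultimately show ?thesis
    using linear_0[OF multivector_linear[OF multivector assms(2)]]
    by (simp add: second_order_defect_def hessian_blinfun)
qed

text \<open>
  Any two lists of covectors are the differentials of linear functions, whose Hessians vanish.
\<close>
lemma first_order_defect_eq_0:
  assumes F: "filippov_identity_on n (range blinfun_apply) (bracket \<Lambda>)"
    and \<gamma>: "Suc (length \<gamma>) = n" and \<beta>: "length \<beta> = n"
  shows "first_order_defect p \<gamma> \<beta> = 0"
proof -
  let ?fs = "map blinfun_apply \<gamma>" and ?gs = "map blinfun_apply \<beta>"
  have "bracket \<Lambda> (?fs @ [bracket \<Lambda> ?gs]) p =
      (\<Sum>i<n. bracket \<Lambda> (?gs[i := bracket \<Lambda> (?fs @ [?gs ! i])]) p)"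
    using F[unfolded filippov_identity_on_def, rule_format, of ?fs ?gs p] \<gamma> \<beta> by auto
  moreover have "map (\<lambda>f. differential f p) (map blinfun_apply \<alpha>s) = \<alpha>s" for \<alpha>s :: "('m \<Rightarrow>\<^sub>L real) list"
    by (simp add: o_def differential_blinfun)
  moreover have "(\<Sum>j<length ?fs. second_order_defect (?fs ! j) j p \<gamma> \<beta>) = 0"
    using \<gamma> \<beta> by (intro sum.neutral) (simp add: second_order_defect_blinfun)
  moreover have "smooth f" if "f \<in> set ?fs \<or> f \<in> set ?gs" for f
    using that smooth_blinfun by auto
  ultimately show ?thesis using filippov_defect[of ?fs ?gs p] \<gamma> \<beta> by simp
qed

text \<open>
  Expanding the inner covector in the frame and applying the Pluecker relation leaves
  \<open>\<Lambda> p \<beta>\<close> times the contraction of the symmetric array \<open>H(w\<^sub>k, w\<^sub>l)\<close> with the array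
  \<open>\<Lambda>(\<dots>, e\<^sub>l, \<dots>, e\<^sub>k)\<close>, which is antisymmetric in \<open>k\<close> and \<open>l\<close>.
\<close>
lemma second_order_defect_wedge:
  assumes f: "smooth f" and \<gamma>: "Suc (length \<gamma>) = n" and \<beta>: "length \<beta> = n" and j: "j < length \<gamma>"
    and vs: "length vs = n" "\<And>\<alpha>s. length \<alpha>s = n \<Longrightarrow> \<Lambda> p \<alpha>s = wedge vs \<alpha>s"
  shows "second_order_defect f j p \<gamma> \<beta> = 0"
proof -
  define H where "H k = hessian f p (w k)" for k
  define a where "a k l = \<Lambda> p (\<gamma>[j := e l] @ [e k])" for k l
  have expand: "\<Lambda> p (\<beta>[i := Blinfun (\<lambda>h. \<Lambda> p (\<gamma>[j := hessian f p h] @ [\<beta> ! i]))]) =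
      (\<Sum>k<m. \<Lambda> p (\<gamma>[j := H k] @ [\<beta> ! i]) * \<Lambda> p (\<beta>[i := e k]))" if i: "i < n" for i
  proof -
    let ?B = "Blinfun (\<lambda>h. \<Lambda> p (\<gamma>[j := hessian f p h] @ [\<beta> ! i]))"
    have "?B = (\<Sum>k<m. blinfun_apply ?B (w k) *\<^sub>R e k)" by (rule covector_expand)
    also have "\<dots> = (\<Sum>k<m. \<Lambda> p (\<gamma>[j := H k] @ [\<beta> ! i]) *\<^sub>R e k)"
      unfolding Blinfun_linear[OF linear_hessian_inner_slot[OF f \<gamma> j]] H_def ..
    finally show ?thesis by (simp add: multivector_sum_update[OF multivector \<beta> i])
  qed
  have pluecker: "(\<Sum>i<n. \<Lambda> p (\<gamma>[j := \<alpha>] @ [\<beta> ! i]) * \<Lambda> p (\<beta>[i := x])) =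
      \<Lambda> p (\<gamma>[j := \<alpha>] @ [x]) * \<Lambda> p \<beta>" for \<alpha> x
    using wedge_pluecker[OF vs(1), of "\<gamma>[j := \<alpha>]" \<beta> x] \<gamma> \<beta> by (simp add: vs(2))
  have "second_order_defect f j p \<gamma> \<beta> =
      (\<Sum>k<m. \<Sum>i<n. \<Lambda> p (\<gamma>[j := H k] @ [\<beta> ! i]) * \<Lambda> p (\<beta>[i := e k]))"
    unfolding second_order_defect_def by (subst sum.swap) (simp add: expand)
  also have "\<dots> = (\<Sum>k<m. \<Lambda> p (\<gamma>[j := H k] @ [e k])) * \<Lambda> p \<beta>"
    unfolding pluecker sum_distrib_right ..
  also have "(\<Sum>k<m. \<Lambda> p (\<gamma>[j := H k] @ [e k])) =
      (\<Sum>k<m. \<Sum>l<m. blinfun_apply (H k) (w l) * a k l)"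
  proof (rule sum.cong[OF refl])
    fix k
    have lj: "length (\<gamma> @ [e k]) = n" "j < n" using \<gamma> j by auto
    have up: "\<gamma>[j := \<alpha>] @ [e k] = (\<gamma> @ [e k])[j := \<alpha>]" for \<alpha>
      using j by (simp add: list_update_append)
    have "\<Lambda> p ((\<gamma> @ [e k])[j := H k]) =
        \<Lambda> p ((\<gamma> @ [e k])[j := (\<Sum>l<m. blinfun_apply (H k) (w l) *\<^sub>R e l)])"
      using covector_expand[of "H k"] by (rule arg_cong)
    then show "\<Lambda> p (\<gamma>[j := H k] @ [e k]) = (\<Sum>l<m. blinfun_apply (H k) (w l) * a k l)"
      unfolding a_def up by (simp only: multivector_sum_update[OF multivector lj])
  qed
  also have "\<dots> = 0"
  proof -
    have anti: "a l k = - a k l" for k l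
      using multivector_swap[OF multivector, of "\<gamma>[j := e l] @ [e k]" j "length \<gamma>" p] \<gamma> j
      by (simp add: a_def list_update_append nth_append)
    have sym: "blinfun_apply (H l) (w k) = blinfun_apply (H k) (w l)" for k l
      unfolding H_def by (rule hessian_symmetric[OF f])
    have "(\<Sum>k<m. \<Sum>l<m. blinfun_apply (H k) (w l) * a k l) =
        (\<Sum>k<m. \<Sum>l<m. blinfun_apply (H l) (w k) * a l k)" by (rule sum.swap)
    also have "\<dots> = (\<Sum>k<m. \<Sum>l<m. - (blinfun_apply (H k) (w l) * a k l))"
      by (intro sum.cong refl) (subst anti, subst sym, simp)
    finally show ?thesis by (simp add: sum_negf)
  qed
  finally show ?thesis by simp
qed

text \<open>
  The Filippov identity is tested on linear functions except for the first one, which is the square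
  of a linear function and has the Hessian \<open>2 a \<otimes> a\<close>.  The differential of the square takes the place
  of the first entry of \<open>\<gamma>\<close>; this entry is overwritten in the relation.
\<close>
lemma quadratic_relation:
  assumes F: "filippov_identity_on n {f. smooth f} (bracket \<Lambda>)" and n: "n > 2"
    and \<gamma>: "Suc (length \<gamma>) = n" and \<beta>: "length \<beta> = n"
  shows "(\<Sum>i<n. \<Lambda> p (\<gamma>[0 := a] @ [\<beta> ! i]) * \<Lambda> p (\<beta>[i := a])) = 0"
proof -
  have F1: "filippov_identity_on n (range blinfun_apply) (bracket \<Lambda>)"
    using F smooth_blinfun unfolding filippov_identity_on_def by blast
  define f where "f x = (blinfun_apply a x)\<^sup>2" for x
  define fs where "fs = (map blinfun_apply \<gamma>)[0 := f]"
  define gs where "gs = map blinfun_apply \<beta>"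
  define \<delta> where "\<delta> = map (\<lambda>f. differential f p) fs"
  have sm: "smooth h" if "h \<in> set fs \<union> set gs" for h
    using that smooth_blinfun smooth_square[of a] set_update_subset_insert[of "map blinfun_apply \<gamma>" 0 f]
    unfolding fs_def gs_def f_def[abs_def, symmetric] by auto
  have l: "Suc (length fs) = n" "length gs = n" "Suc (length \<delta>) = n"
    using \<gamma> \<beta> by (simp_all add: fs_def gs_def \<delta>_def)
  have dgs: "map (\<lambda>g. differential g p) gs = \<beta>"
    by (simp add: gs_def o_def differential_blinfun)
  have \<delta>0: "\<delta>[0 := x] = \<gamma>[0 := x]" for x
    by (simp add: \<delta>_def fs_def map_update o_def differential_blinfun)
  have "bracket \<Lambda> (fs @ [bracket \<Lambda> gs]) p = (\<Sum>i<n. bracket \<Lambda> (gs[i := bracket \<Lambda> (fs @ [gs ! i])]) p)"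
    using F[unfolded filippov_identity_on_def, rule_format, of fs gs p] sm l by auto
  then have "0 = first_order_defect p \<delta> \<beta> - (\<Sum>j<length fs. second_order_defect (fs ! j) j p \<delta> \<beta>)"
    using filippov_defect[of fs gs p] sm l by (simp add: dgs \<delta>_def)
  also have "(\<Sum>j<length fs. second_order_defect (fs ! j) j p \<delta> \<beta>) =
      (\<Sum>j<length fs. if j = 0 then second_order_defect f 0 p \<delta> \<beta> else 0)"
  proof (rule sum.cong[OF refl])
    fix j assume "j \<in> {..<length fs}"
    then have j: "j < length \<gamma>" by (simp add: fs_def)
    then have "fs ! j = (if j = 0 then f else blinfun_apply (\<gamma> ! j))"
      by (cases \<gamma>) (auto simp: fs_def nth_list_update)
    then show "second_order_defect (fs ! j) j p \<delta> \<beta> =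
        (if j = 0 then second_order_defect f 0 p \<delta> \<beta> else 0)"
      using second_order_defect_blinfun[OF l(3) \<beta>, of j] j l(3) \<gamma> by simp
  qed
  also have "\<dots> = second_order_defect f 0 p \<delta> \<beta>" using l n by (cases fs) auto
  finally have zero: "second_order_defect f 0 p \<delta> \<beta> = 0"
    using first_order_defect_eq_0[OF F1 l(3) \<beta>] by simp
  have "\<Lambda> p (\<beta>[i := Blinfun (\<lambda>h. \<Lambda> p (\<delta>[0 := hessian f p h] @ [\<beta> ! i]))]) =
      2 * (\<Lambda> p (\<gamma>[0 := a] @ [\<beta> ! i]) * \<Lambda> p (\<beta>[i := a]))" if i: "i < n" for i
  proof -
    have up: "\<gamma>[0 := x] @ [\<beta> ! i] = (\<gamma> @ [\<beta> ! i])[0 := x]" for x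
      using \<gamma> n by (cases \<gamma>) auto
    have lin: "linear (\<lambda>x. \<Lambda> p (\<gamma>[0 := x] @ [\<beta> ! i]))"
      unfolding up using \<gamma> n by (intro multivector_linear[OF multivector]) auto
    have "Blinfun (\<lambda>h. \<Lambda> p (\<delta>[0 := hessian f p h] @ [\<beta> ! i])) =
        Blinfun (blinfun_apply ((2 * \<Lambda> p (\<gamma>[0 := a] @ [\<beta> ! i])) *\<^sub>R a))"
      by (rule arg_cong[where f = Blinfun])
         (simp add: fun_eq_iff f_def[abs_def] hessian_square \<delta>0
           linear_scale[OF lin] blinfun.scaleR_left)
    then show ?thesis
      using linear_scale[OF multivector_linear[OF multivector \<beta> i]]
      by (simp add: blinfun_apply_inverse)
  qed
  then have "second_order_defect f 0 p \<delta> \<beta> =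
      2 * (\<Sum>i<n. \<Lambda> p (\<gamma>[0 := a] @ [\<beta> ! i]) * \<Lambda> p (\<beta>[i := a]))"
    unfolding second_order_defect_def sum_distrib_left by (intro sum.cong) auto
  with zero show ?thesis by simp
qed

text \<open>
  Either side makes the first-order defect vanish at all covectors, so by \<open>filippov_defect\<close> only the
  second-order defects decide between them; these are governed by the algebra of the single form
  \<open>\<Lambda> p\<close>.
\<close>
lemma filippov_smooth_iff:
  assumes n: "n > 2"
  shows "filippov_identity_on n {f. smooth f} (bracket \<Lambda>) \<longleftrightarrow>
    filippov_identity_on n (range blinfun_apply) (bracket \<Lambda>) \<and> decomposable n \<Lambda>"
proof (intro iffI conjI; (elim conjE)?)
  assume F: "filippov_identity_on n {f. smooth f} (bracket \<Lambda>)"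
  then show "filippov_identity_on n (range blinfun_apply) (bracket \<Lambda>)"
    using smooth_blinfun unfolding filippov_identity_on_def by blast
  show "decomposable n \<Lambda>"
    unfolding decomposable_def
    using decomposable_if_quadratic_relation[OF multivector n reflexive quadratic_relation[OF F n]]
    by blast
next
  assume F: "filippov_identity_on n (range blinfun_apply) (bracket \<Lambda>)" and D: "decomposable n \<Lambda>"
  show "filippov_identity_on n {f. smooth f} (bracket \<Lambda>)"
    unfolding filippov_identity_on_def
  proof (intro allI impI)
    fix fs gs :: "('m \<Rightarrow> real) list" and p :: 'm
    assume l: "length fs + 1 = n" "length gs = n" and S: "set fs \<subseteq> {f. smooth f}" "set gs \<subseteq> {f. smooth f}"
    let ?\<gamma> = "map (\<lambda>f. differential f p) fs" and ?\<beta> = "map (\<lambda>g. differential g p) gs"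
    obtain vs where vs: "length vs = n" "\<And>\<alpha>s. length \<alpha>s = n \<Longrightarrow> \<Lambda> p \<alpha>s = wedge vs \<alpha>s"
      using D unfolding decomposable_def by blast
    have "smooth (fs ! j)" if "j < length fs" for j
      using that S(1) nth_mem by blast
    then have "(\<Sum>j<length fs. second_order_defect (fs ! j) j p ?\<gamma> ?\<beta>) = 0"
      using l vs by (intro sum.neutral ballI second_order_defect_wedge[where vs = vs]) auto
    moreover have "first_order_defect p ?\<gamma> ?\<beta> = 0"
      using l by (intro first_order_defect_eq_0[OF F]) auto
    ultimately show "bracket \<Lambda> (fs @ [bracket \<Lambda> gs]) p =
        (\<Sum>i<n. bracket \<Lambda> (gs[i := bracket \<Lambda> (fs @ [gs ! i])]) p)"
      using filippov_defect[of fs gs p] l S by auto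
  qed
qed

end

text \<open>
  It remains to produce a frame of the dual space and to identify its covectors with the evaluations
  at vectors of the original space.
\<close>
theorem theorem1:
  fixes \<Lambda> :: "'v::real_normed_vector dual multivector_field"
    and n :: nat
  assumes finite_dim: "\<exists>B :: 'v set. finite B \<and> span B = UNIV"
    and n: "n > 2"
    and lin: "linear_multivector_field n \<Lambda>"
  shows "nambu_poisson n \<Lambda> \<longleftrightarrow> filippov_tensor n \<Lambda> \<and> decomposable n \<Lambda>"
proof -
  obtain B :: "'v set" where B: "finite B" "span B = UNIV" using finite_dim by blast
  have "\<phi> = 0" if "\<forall>b\<in>B. blinfun_apply \<phi> b = 0" for \<phi> :: "'v dual"
  proof (rule blinfun_eqI)
    fix x
    have "linear (blinfun_apply \<phi>)"
      by (rule bounded_linear.linear[OF blinfun.bounded_linear_right])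
    then show "blinfun_apply \<phi> x = blinfun_apply 0 x"
      using linear_eq_0_on_span[of "blinfun_apply \<phi>" B x] that B by simp
  qed
  then have "\<exists>m v w. \<forall>\<phi>\<in>(UNIV :: 'v dual set). \<phi> = (\<Sum>k<(m::nat). blinfun_apply \<phi> (v k) *\<^sub>R w k)"
    by (intro dual_frame_on_subspace[OF B(1) subspace_UNIV])
  then obtain m v w where
    frame: "\<And>\<phi> :: 'v dual. \<phi> = (\<Sum>k<(m::nat). blinfun_apply \<phi> (v k) *\<^sub>R w k)"
    by (elim exE) (auto simp only: UNIV_I ball_UNIV)
  define ev where "ev x = Blinfun (\<lambda>\<phi> :: 'v dual. blinfun_apply \<phi> x)" for x
  have ev: "blinfun_apply (ev x) = lin_fun x" for x
    unfolding ev_def lin_fun_def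
    by (intro bounded_linear_Blinfun_apply blinfun.bounded_linear_left)
  interpret finite_frame m "\<lambda>k. ev (v k)" w
    by unfold_locales (unfold ev lin_fun_def, rule frame)
  \<comment> \<open>\<open>pre\<close> inverts the embedding into the bidual, so every covector is the differential of some
    \<open>lin_fun\<close>, and linearity of the coefficients extends to all arguments.\<close>
  define pre where "pre \<alpha> = (\<Sum>k<m. blinfun_apply \<alpha> (w k) *\<^sub>R v k)" for \<alpha> :: "'v dual \<Rightarrow>\<^sub>L real"
  have pre: "lin_fun (pre \<alpha>) = blinfun_apply \<alpha>" for \<alpha>
  proof
    fix \<phi>
    have "blinfun_apply \<alpha> \<phi> = blinfun_apply (\<Sum>k<m. blinfun_apply \<alpha> (w k) *\<^sub>R ev (v k)) \<phi>"
      by (rule arg_cong[where f = "\<lambda>\<alpha>. blinfun_apply \<alpha> \<phi>", OF covector_expand])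
    then show "lin_fun (pre \<alpha>) \<phi> = blinfun_apply \<alpha> \<phi>"
      by (simp only: pre_def lin_fun_def ev blinfun.sum_left blinfun.sum_right
          blinfun.scaleR_left blinfun.scaleR_right)
  qed
  have range: "range lin_fun = range (blinfun_apply :: ('v dual \<Rightarrow>\<^sub>L real) \<Rightarrow> _)"
  proof (intro equalityI image_subsetI)
    fix x :: 'v show "lin_fun x \<in> range blinfun_apply" using ev by (metis rangeI)
  next
    fix \<alpha> :: "'v dual \<Rightarrow>\<^sub>L real" show "blinfun_apply \<alpha> \<in> range lin_fun" using pre by (metis rangeI)
  qed
  have mv: "is_multivector_field n \<Lambda>" using lin by (simp add: linear_multivector_field_def)
  have linear_in_point: "linear (\<lambda>p. \<Lambda> p \<alpha>s)" if "length \<alpha>s = n" for \<alpha>s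
  proof -
    have "bracket \<Lambda> (map lin_fun (map pre \<alpha>s)) = (\<lambda>p. \<Lambda> p \<alpha>s)"
      by (simp add: bracket_def pre o_def differential_blinfun)
    then show ?thesis
      using lin that unfolding linear_multivector_field_def by (metis length_map)
  qed
  interpret linear_field_on_frame m "\<lambda>k. ev (v k)" w n \<Lambda>
  proof (intro linear_field_on_frame.intro finite_frame_axioms linear_field_on_frame_axioms.intro)
    show "is_multivector n (\<Lambda> p)" for p using mv by (simp add: is_multivector_field_def)
  qed (rule linear_in_point)
  show ?thesis
    using filippov_smooth_iff[OF n] lin mv
    by (simp add: nambu_poisson_def filippov_tensor_def range)
qed

end
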